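(* Let $\Omega\subset\mathbb{R}^N$ be a bounded domain with $C^1$ boundary and $0<\alpha<\beta\le1$. Let $v_0\in L^\infty(\Omega)$, $v_0\ge0$. Assume that $\beta=1$ or that there is a constant $K_0>0$ with $v_0(x)\ge K_0\,\mathrm{dist}(x,\partial\Omega)^{2/(1-\alpha)}$ for any $x\in\overline{\Omega}$. Given $\lambda>0$, assume that $\|v_0\|_{L^\infty(\Omega)}<\lambda^{-1/(\beta-\alpha)}$. Then the solution $v$ of $PP(\alpha,\beta,\lambda,v_0)$ satisfies $v(t)\to0$ in $L^\infty(\Omega)$ as $t\to+\infty$.
   Context: $PP(\alpha,\beta,\lambda,v_0)$: $v_t-\Delta v+|v|^{\alpha-1}v=\lambda|v|^{\beta-1}v$ in $(0,\infty)\times\Omega$, $v=0$ on $(0,\infty)\times\partial\Omega$, $v(0,x)=v_0(x)$ on $\Omega$. For $v_0\in L^\infty(\Omega)$, $v_0\ge0$, a (weak) solution is $v\in C([0,\infty),L^2(\Omega))$ with $v\ge0$, $\lambda v^\beta-v^\alpha\in L^\infty((0,T)\times\Omega)$ for all $T>0$, and $v(t)=T(t)v_0+\int_0^tT(t-s)(\lambda v^\beta(s)-v^\alpha(s))\,ds$, where $(T(t))_{t\ge0}$ is the heat semigroup with homogeneous Dirichlet conditions. *)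

theory Defs
  imports "HOL-Analysis.Analysis" "HOL-Probability.Essential_Supremum"
begin

section \<open>The Hilbert space of square integrable functions\<close>

definition square_integrable :: "('a::euclidean_space \<Rightarrow> real) \<Rightarrow> bool" where
  "square_integrable f \<longleftrightarrow> f \<in> borel_measurable lebesgue \<and> integrable lebesgue (\<lambda>x. (f x)\<^sup>2)"

lemma square_integrable_zero: "square_integrable (\<lambda>x. 0)"
  by (simp add: square_integrable_def)

lemma square_integrable_mult:
  assumes "square_integrable f" "square_integrable g"
  shows "integrable lebesgue (\<lambda>x. f x * g x)"
proof (rule Bochner_Integration.integrable_bound)
  show "integrable lebesgue (\<lambda>x. (f x)\<^sup>2 + (g x)\<^sup>2)"
    using assms by (simp add: square_integrable_def)
  show "(\<lambda>x. f x * g x) \<in> borel_measurable lebesgue"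
    using assms by (auto simp: square_integrable_def intro!: borel_measurable_times)
  have "\<bar>a * b\<bar> \<le> \<bar>a\<^sup>2 + b\<^sup>2\<bar>" for a b :: real
  proof -
    have "0 \<le> (\<bar>a\<bar> - \<bar>b\<bar>)\<^sup>2" by simp
    then have "2 * \<bar>a * b\<bar> \<le> a\<^sup>2 + b\<^sup>2" by (simp add: power2_diff abs_mult)
    then show ?thesis by (smt (verit))
  qed
  then show "AE x in lebesgue. norm (f x * g x) \<le> norm ((f x)\<^sup>2 + (g x)\<^sup>2)" by simp
qed

lemma square_integrable_add:
  assumes "square_integrable f" "square_integrable g"
  shows "square_integrable (\<lambda>x. f x + g x)"
proof -
  have "integrable lebesgue (\<lambda>x. (f x)\<^sup>2 + (g x)\<^sup>2 + 2 * (f x * g x))"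
    using assms square_integrable_mult[OF assms] by (simp add: square_integrable_def)
  then show ?thesis
    using assms by (auto simp: square_integrable_def power2_sum mult.assoc intro!: borel_measurable_add)
qed

lemma square_integrable_scale:
  assumes "square_integrable f"
  shows "square_integrable (\<lambda>x. c * f x)"
  using assms by (auto simp: square_integrable_def power_mult_distrib intro!: borel_measurable_times)

definition l2rel :: "('a::euclidean_space \<Rightarrow> real) \<Rightarrow> ('a \<Rightarrow> real) \<Rightarrow> bool" where
  "l2rel f g \<longleftrightarrow> square_integrable f \<and> square_integrable g \<and> (AE x in lebesgue. f x = g x)"

lemma part_equivp_l2rel: "part_equivp (l2rel :: ('a::euclidean_space \<Rightarrow> real) \<Rightarrow> _)"
proof (rule part_equivpI)
  show "\<exists>f :: 'a \<Rightarrow> real. l2rel f f"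
    by (rule exI[of _ "\<lambda>x. 0"]) (simp add: l2rel_def square_integrable_zero)
  show "symp (l2rel :: ('a \<Rightarrow> real) \<Rightarrow> _)"
    by (auto simp: symp_def l2rel_def elim: eventually_mono)
  show "transp (l2rel :: ('a \<Rightarrow> real) \<Rightarrow> _)"
  proof (rule transpI)
    fix f g h :: "'a \<Rightarrow> real"
    assume A: "l2rel f g" "l2rel g h"
    then have "AE x in lebesgue. f x = g x" "AE x in lebesgue. g x = h x"
      by (simp_all add: l2rel_def)
    then have "AE x in lebesgue. f x = h x" by eventually_elim simp
    with A show "l2rel f h" by (simp add: l2rel_def)
  qed
qed

quotient_type (overloaded) 'a l2 = "'a::euclidean_space \<Rightarrow> real" / partial: l2rel
  by (rule part_equivp_l2rel)

instantiation l2 :: (euclidean_space) real_inner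
begin

lift_definition zero_l2 :: "'a l2" is "\<lambda>x. 0"
  by (simp add: l2rel_def square_integrable_zero)

lift_definition plus_l2 :: "'a l2 \<Rightarrow> 'a l2 \<Rightarrow> 'a l2" is "\<lambda>f g x. f x + g x"
proof -
  fix f f' g g' :: "'a \<Rightarrow> real"
  assume A: "l2rel f f'" "l2rel g g'"
  then have "AE x in lebesgue. f x = f' x" "AE x in lebesgue. g x = g' x"
    by (simp_all add: l2rel_def)
  then have "AE x in lebesgue. f x + g x = f' x + g' x" by eventually_elim simp
  with A show "l2rel (\<lambda>x. f x + g x) (\<lambda>x. f' x + g' x)"
    by (simp add: l2rel_def square_integrable_add)
qed

lift_definition scaleR_l2 :: "real \<Rightarrow> 'a l2 \<Rightarrow> 'a l2" is "\<lambda>c f x. c * f x"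
proof -
  fix c :: real and f g :: "'a \<Rightarrow> real"
  assume A: "l2rel f g"
  then have "AE x in lebesgue. f x = g x" by (simp add: l2rel_def)
  then have "AE x in lebesgue. c * f x = c * g x" by eventually_elim simp
  with A show "l2rel (\<lambda>x. c * f x) (\<lambda>x. c * g x)"
    by (simp add: l2rel_def square_integrable_scale)
qed

definition uminus_l2 :: "'a l2 \<Rightarrow> 'a l2" where "uminus_l2 u = (-1) *\<^sub>R u"

definition minus_l2 :: "'a l2 \<Rightarrow> 'a l2 \<Rightarrow> 'a l2" where "minus_l2 u w = u + (-1) *\<^sub>R w"

lift_definition inner_l2 :: "'a l2 \<Rightarrow> 'a l2 \<Rightarrow> real" is "\<lambda>f g. \<integral>x. f x * g x \<partial>lebesgue"
proof -
  fix f f' g g' :: "'a \<Rightarrow> real"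
  assume A: "l2rel f f'" "l2rel g g'"
  then have "AE x in lebesgue. f x = f' x" "AE x in lebesgue. g x = g' x"
    by (simp_all add: l2rel_def)
  then have "AE x in lebesgue. f x * g x = f' x * g' x" by eventually_elim simp
  then show "(\<integral>x. f x * g x \<partial>lebesgue) = (\<integral>x. f' x * g' x \<partial>lebesgue)"
  proof (rule integral_cong_AE[rotated 2])
  qed (use A in \<open>auto simp: l2rel_def square_integrable_def\<close>)
qed

definition norm_l2 :: "'a l2 \<Rightarrow> real" where "norm_l2 u = sqrt (inner u u)"

definition sgn_l2 :: "'a l2 \<Rightarrow> 'a l2" where "sgn_l2 u = inverse (norm u) *\<^sub>R u"

definition dist_l2 :: "'a l2 \<Rightarrow> 'a l2 \<Rightarrow> real" where "dist_l2 u w = norm (u - w)"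

definition uniformity_l2 :: "('a l2 \<times> 'a l2) filter" where
  "uniformity_l2 = (INF e\<in>{0 <..}. principal {(u, w). dist u w < e})"

definition open_l2 :: "'a l2 set \<Rightarrow> bool" where
  "open_l2 U \<longleftrightarrow> (\<forall>u\<in>U. eventually (\<lambda>(u', w). u' = u \<longrightarrow> w \<in> U) uniformity)"

instance
proof
  fix a b c u w z :: "'a l2" and r s :: real and U :: "'a l2 set"
  show "a + b + c = a + (b + c)"
    by transfer (auto simp: l2rel_def algebra_simps intro!: square_integrable_add)
  show "a + b = b + a"
    by transfer (auto simp: l2rel_def algebra_simps intro!: square_integrable_add)
  show "0 + a = a"
    by transfer simp
  show "- a + a = 0"
    unfolding uminus_l2_def
    by transfer (auto simp: l2rel_def square_integrable_zero)
  show "a - b = a + - b"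
    by (simp add: uminus_l2_def minus_l2_def)
  show "r *\<^sub>R (a + b) = r *\<^sub>R a + r *\<^sub>R b"
    by transfer (auto simp: l2rel_def algebra_simps intro!: square_integrable_add square_integrable_scale)
  show "(r + s) *\<^sub>R a = r *\<^sub>R a + s *\<^sub>R a"
    apply transfer
    apply (simp add: l2rel_def distrib_right)
    apply (auto intro!: square_integrable_add square_integrable_scale)
    done
  show "r *\<^sub>R s *\<^sub>R a = (r * s) *\<^sub>R a"
    apply transfer
    apply (simp add: l2rel_def mult.assoc[symmetric])
    apply (auto intro!: square_integrable_scale)
    done
  show "1 *\<^sub>R a = a"
    by transfer simp
  show "sgn a = inverse (norm a) *\<^sub>R a"
    by (rule sgn_l2_def)
  show "dist a b = norm (a - b)"
    by (rule dist_l2_def)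
  show "(uniformity :: ('a l2 \<times> 'a l2) filter) = (INF e\<in>{0 <..}. principal {(u, w). dist u w < e})"
    by (rule uniformity_l2_def)
  show "open U \<longleftrightarrow> (\<forall>u\<in>U. eventually (\<lambda>(u', w). u' = u \<longrightarrow> w \<in> U) uniformity)"
    by (rule open_l2_def)
  show "inner a b = inner b a"
    by transfer (simp add: mult.commute)
  show "inner (a + b) c = inner a c + inner b c"
    by transfer (simp add: l2rel_def distrib_right square_integrable_mult)
  show "inner (r *\<^sub>R a) b = r * inner a b"
    by transfer (simp add: mult.assoc)
  show "0 \<le> inner a a"
    by transfer simp
  show "inner a a = 0 \<longleftrightarrow> a = 0"
  proof transfer
    fix f :: "'a \<Rightarrow> real"
    assume "l2rel f f"
    then have f: "square_integrable f" by (simp add: l2rel_def)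
    then have "integrable lebesgue (\<lambda>x. f x * f x)" by (rule square_integrable_mult[OF _ f])
    then have "(\<integral>x. f x * f x \<partial>lebesgue) = 0 \<longleftrightarrow> (AE x in lebesgue. f x * f x = 0)"
      by (rule integral_nonneg_eq_0_iff_AE) simp
    then show "(\<integral>x. f x * f x \<partial>lebesgue) = 0 \<longleftrightarrow> l2rel f (\<lambda>x. 0)"
      using f by (simp add: l2rel_def square_integrable_zero)
  qed
  show "norm a = sqrt (inner a a)"
    by (rule norm_l2_def)
qed

end

lemma square_integrable_rep_l2: "square_integrable (rep_l2 u)"
  using Quotient_rep_reflp[OF Quotient_l2, of u] by (simp add: l2rel_def)

lemma abs_rep_l2: "abs_l2 (rep_l2 u) = u"
  by (rule Quotient_abs_rep[OF Quotient_l2])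

lemma rep_abs_l2: "square_integrable f \<Longrightarrow> AE x in lebesgue. rep_l2 (abs_l2 f) x = f x"
  using Quotient_rep_abs[OF Quotient_l2, of f] by (simp add: l2rel_def)

lemma abs_l2_eqI:
  "square_integrable f \<Longrightarrow> square_integrable g \<Longrightarrow> AE x in lebesgue. f x = g x \<Longrightarrow> abs_l2 f = abs_l2 g"
  using Quotient_rel_abs[OF Quotient_l2, of f g] by (simp add: l2rel_def)

lemma square_integrable_diff:
  assumes "square_integrable f" "square_integrable g"
  shows "square_integrable (\<lambda>x. f x - g x)"
  using square_integrable_add[OF assms(1) square_integrable_scale[OF assms(2), of "-1"]] by simp

lemma abs_l2_diff:
  assumes "square_integrable f" "square_integrable g"
  shows "abs_l2 f - abs_l2 g = abs_l2 (\<lambda>x. f x - g x)"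
proof -
  have f: "l2rel f f" and g: "l2rel g g" and h: "l2rel (\<lambda>x. -1 * g x) (\<lambda>x. -1 * g x)"
    using assms square_integrable_scale[OF assms(2), of "-1"] by (simp_all add: l2rel_def)
  show ?thesis
    unfolding minus_l2_def scaleR_l2.abs_eq[OF g] plus_l2.abs_eq[OF f h] by simp
qed

lemma norm_abs_l2:
  assumes "square_integrable f"
  shows "(norm (abs_l2 f))\<^sup>2 = (\<integral>x. (f x)\<^sup>2 \<partial>lebesgue)"
proof -
  have f: "l2rel f f" using assms by (simp add: l2rel_def)
  show ?thesis
    unfolding power2_norm_eq_inner inner_l2.abs_eq[OF f f] by (simp add: power2_eq_square)
qed

lemma nn_integral_norm_l2:
  assumes "square_integrable f"
  shows "(\<integral>\<^sup>+x. ennreal ((f x)\<^sup>2) \<partial>lebesgue) = ennreal ((norm (abs_l2 f))\<^sup>2)"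
  unfolding norm_abs_l2[OF assms]
  using assms by (intro nn_integral_eq_integral) (auto simp: square_integrable_def)

instance l2 :: (euclidean_space) complete_space
proof
  fix X :: "nat \<Rightarrow> 'a l2"
  assume C: "Cauchy X"
  have "\<exists>N. \<forall>m\<ge>N. \<forall>n\<ge>N. norm (X m - X n) < (1/2)^k" for k
    using C unfolding Cauchy_def dist_norm by simp
  then have "\<forall>k. \<exists>N. \<forall>m\<ge>N. \<forall>n\<ge>N. norm (X m - X n) < (1/2)^k" by blast
  then obtain N where "\<forall>k. \<forall>m\<ge>N k. \<forall>n\<ge>N k. norm (X m - X n) < (1/2)^k"
    by (rule choice[THEN exE])
  then have N: "\<And>k m n. m \<ge> N k \<Longrightarrow> n \<ge> N k \<Longrightarrow> norm (X m - X n) < (1/2)^k"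
    by blast
  define r where "r = rec_nat (N 0) (\<lambda>k i. max (Suc i) (N (Suc k)))"
  have r_Suc: "r (Suc k) = max (Suc (r k)) (N (Suc k))" for k by (simp add: r_def)
  have r_mono: "strict_mono r" by (rule strict_monoI_Suc) (simp add: r_Suc)
  have rN: "N k \<le> r k" for k by (cases k) (simp_all add: r_def)
  define F where "F k = rep_l2 (X (r k))" for k
  have sF: "square_integrable (F k)" for k
    unfolding F_def by (rule square_integrable_rep_l2)
  have mF[measurable]: "F k \<in> borel_measurable lebesgue" for k
    using sF by (simp add: square_integrable_def)
  have absF: "abs_l2 (F k) = X (r k)" for k by (simp add: F_def abs_rep_l2)
  have small: "(\<integral>\<^sup>+x. ennreal ((F m x - F k x)\<^sup>2) \<partial>lebesgue) \<le> ennreal ((1/4)^k)" if "k \<le> m" for k m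
  proof -
    have "r k \<le> r m" using r_mono that by (simp add: strict_mono_less_eq)
    then have "norm (X (r m) - X (r k)) < (1/2)^k" using rN[of k] by (intro N) auto
    then have "(norm (X (r m) - X (r k)))\<^sup>2 \<le> ((1/2)^k)\<^sup>2" by (intro power_mono) auto
    also have "((1/2)^k)\<^sup>2 = (1/4::real)^k"
      by (simp add: power2_eq_square flip: power_mult_distrib)
    finally show ?thesis
      by (simp add: nn_integral_norm_l2[OF square_integrable_diff[OF sF sF]]
          abs_l2_diff[OF sF sF, symmetric] absF ennreal_leI)
  qed
  have "(\<integral>\<^sup>+x. (\<Sum>k. ennreal (2^k * (F (Suc k) x - F k x)\<^sup>2)) \<partial>lebesgue)
      = (\<Sum>k. \<integral>\<^sup>+x. ennreal (2^k * (F (Suc k) x - F k x)\<^sup>2) \<partial>lebesgue)"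
    by (rule nn_integral_suminf) simp
  also have "\<dots> \<le> (\<Sum>k. ennreal ((1/2)^k))"
  proof (intro suminf_le summableI)
    fix k
    have "(\<integral>\<^sup>+x. ennreal (2^k * (F (Suc k) x - F k x)\<^sup>2) \<partial>lebesgue)
        = ennreal (2^k) * (\<integral>\<^sup>+x. ennreal ((F (Suc k) x - F k x)\<^sup>2) \<partial>lebesgue)"
      by (subst nn_integral_cmult[symmetric]) (simp_all add: ennreal_mult)
    also have "\<dots> \<le> ennreal (2^k) * ennreal ((1/4)^k)"
      by (intro mult_left_mono small) auto
    also have "\<dots> = ennreal ((1/2)^k)"
      by (simp add: ennreal_mult[symmetric] power_mult_distrib[symmetric])
    finally show "(\<integral>\<^sup>+x. ennreal (2^k * (F (Suc k) x - F k x)\<^sup>2) \<partial>lebesgue) \<le> ennreal ((1/2)^k)" .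
  qed
  also have "\<dots> = ennreal (\<Sum>k. (1/2)^k)"
    by (intro suminf_ennreal_eq summable_sums) (simp_all add: summable_geometric)
  also have "\<dots> < \<infinity>" by simp
  finally have "AE x in lebesgue. (\<Sum>k. ennreal (2^k * (F (Suc k) x - F k x)\<^sup>2)) \<noteq> \<infinity>"
    by (intro nn_integral_noteq_infinite) auto
  then have conv: "AE x in lebesgue. (\<lambda>k. F k x) \<longlonglongrightarrow> lim (\<lambda>k. F k x)"
  proof (rule eventually_mono)
    fix x assume "(\<Sum>k. ennreal (2^k * (F (Suc k) x - F k x)\<^sup>2)) \<noteq> \<infinity>"
    then have "summable (\<lambda>k. 2^k * (F (Suc k) x - F k x)\<^sup>2)"
      by (intro summable_suminf_not_top) auto
    then have "summable (\<lambda>k. 2^k * (F (Suc k) x - F k x)\<^sup>2 + (1/2)^k)"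
      by (intro summable_add) (simp_all add: summable_geometric)
    then have "summable (\<lambda>k. F (Suc k) x - F k x)"
    proof (rule summable_comparison_test')
      fix k :: nat
      define d where "d = \<bar>F (Suc k) x - F k x\<bar>"
      define c where "c = (2::real)^k"
      have c: "c \<ge> 1" unfolding c_def by simp
      have "d \<le> c * d\<^sup>2 + 1 / c"
      proof -
        have "0 \<le> (c * d - 1)\<^sup>2" by simp
        then have "2 * (c * d) \<le> c\<^sup>2 * d\<^sup>2 + 1" by (simp add: power2_diff power_mult_distrib)
        moreover have "0 \<le> c * d" using c by (simp add: d_def)
        ultimately have "c * d \<le> c * (c * d\<^sup>2 + 1 / c)"
          using c by (simp add: distrib_left power2_eq_square)
        then show ?thesis using c by (simp add: mult_le_cancel_left)
      qed
      then show "norm (F (Suc k) x - F k x) \<le> 2^k * (F (Suc k) x - F k x)\<^sup>2 + (1/2)^k"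
        by (simp add: d_def c_def power_one_over)
    qed
    then have "convergent (\<lambda>n. \<Sum>k<n. F (Suc k) x - F k x)"
      by (simp add: summable_iff_convergent)
    then obtain l where "(\<lambda>n. F n x - F 0 x) \<longlonglongrightarrow> l"
      by (auto simp: convergent_def sum_lessThan_telescope[of "\<lambda>k. F k x"])
    then have "(\<lambda>n. (F n x - F 0 x) + F 0 x) \<longlonglongrightarrow> l + F 0 x"
      by (intro tendsto_add) auto
    then show "(\<lambda>k. F k x) \<longlonglongrightarrow> lim (\<lambda>k. F k x)"
      by (simp add: convergent_LIMSEQ_iff[symmetric] convergentI)
  qed
  define f where "f x = lim (\<lambda>k. F k x)" for x
  have mf[measurable]: "f \<in> borel_measurable lebesgue"
    unfolding f_def by measurable
  have fat: "(\<integral>\<^sup>+x. ennreal ((f x - F k x)\<^sup>2) \<partial>lebesgue) \<le> ennreal ((1/4)^k)" for k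
  proof -
    have "(\<integral>\<^sup>+x. ennreal ((f x - F k x)\<^sup>2) \<partial>lebesgue)
        = (\<integral>\<^sup>+x. liminf (\<lambda>m. ennreal ((F m x - F k x)\<^sup>2)) \<partial>lebesgue)"
    proof (rule nn_integral_cong_AE, use conv in \<open>rule eventually_mono\<close>)
      fix x assume "(\<lambda>k. F k x) \<longlonglongrightarrow> lim (\<lambda>k. F k x)"
      then have "(\<lambda>m. ennreal ((F m x - F k x)\<^sup>2)) \<longlonglongrightarrow> ennreal ((f x - F k x)\<^sup>2)"
        unfolding f_def by (intro tendsto_intros)
      then show "ennreal ((f x - F k x)\<^sup>2) = liminf (\<lambda>m. ennreal ((F m x - F k x)\<^sup>2))"
        by (intro lim_imp_Liminf[symmetric] trivial_limit_sequentially)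
    qed
    also have "\<dots> \<le> liminf (\<lambda>m. \<integral>\<^sup>+x. ennreal ((F m x - F k x)\<^sup>2) \<partial>lebesgue)"
      by (rule nn_integral_liminf) simp
    also have "\<dots> \<le> liminf (\<lambda>m::nat. ennreal ((1/4)^k))"
      by (intro Liminf_mono eventually_mono[OF eventually_ge_at_top[of k]] small)
    also have "\<dots> = ennreal ((1/4)^k)" by (simp add: Liminf_const)
    finally show ?thesis .
  qed
  have sd: "square_integrable (\<lambda>x. f x - F k x)" for k
    unfolding square_integrable_def
  proof
    show "integrable lebesgue (\<lambda>x. (f x - F k x)\<^sup>2)"
    proof (rule integrableI_nonneg)
      have "(\<integral>\<^sup>+x. ennreal ((f x - F k x)\<^sup>2) \<partial>lebesgue) \<le> ennreal ((1/4)^k)" by (rule fat)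
      also have "\<dots> < \<infinity>" by simp
      finally show "(\<integral>\<^sup>+x. ennreal ((f x - F k x)\<^sup>2) \<partial>lebesgue) < \<infinity>" .
    qed auto
  qed simp
  have sf: "square_integrable f"
    using square_integrable_add[OF sd[of 0] sF[of 0]] by simp
  have "norm (X (r k) - abs_l2 f) \<le> (1/2)^k" for k
  proof -
    have "ennreal ((norm (abs_l2 f - X (r k)))\<^sup>2) \<le> ennreal ((1/4)^k)"
      using fat[of k] by (simp add: nn_integral_norm_l2[OF sd] absF[symmetric] abs_l2_diff[OF sf sF])
    then have "(norm (abs_l2 f - X (r k)))\<^sup>2 \<le> (1/4)^k" by (simp add: ennreal_le_iff)
    also have "(1/4::real)^k = ((1/2)^k)\<^sup>2"
      by (simp add: power2_eq_square flip: power_mult_distrib)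
    finally show ?thesis
      unfolding norm_minus_commute[of "X (r k)"] by (rule power2_le_imp_le) simp
  qed
  then have "(\<lambda>k. X (r k) - abs_l2 f) \<longlonglongrightarrow> 0"
    by (intro Lim_null_comparison[OF always_eventually LIMSEQ_realpow_zero[of "1/2"]]) auto
  then have "(X \<circ> r) \<longlonglongrightarrow> abs_l2 f"
    by (simp add: LIM_zero_iff o_def)
  then show "convergent X"
    using Cauchy_converges_subseq[OF C r_mono] by (auto simp: convergent_def)
qed

instance l2 :: (euclidean_space) banach ..


section \<open>Function spaces on an open set\<close>

text \<open>\<open>'a l2\<close> is \<open>L\<^sup>2\<close> of the whole space. \<open>L\<^sup>2(\<Omega>)\<close> is identified, isometrically, with the closed
  subspace of the classes vanishing almost everywhere outside \<open>\<Omega>\<close>. The class \<open>l2_on \<Omega> f\<close> is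
  meaningful only if the extension of \<open>f\<close> by zero is square integrable.\<close>

definition L2 :: "'a::euclidean_space set \<Rightarrow> 'a l2 set" where
  "L2 \<Omega> = {u. AE x in lebesgue. x \<notin> \<Omega> \<longrightarrow> rep_l2 u x = 0}"

definition l2_on :: "'a::euclidean_space set \<Rightarrow> ('a \<Rightarrow> real) \<Rightarrow> 'a l2" where
  "l2_on \<Omega> f = abs_l2 (\<lambda>x. if x \<in> \<Omega> then f x else 0)"

definition Linf_norm :: "'a::euclidean_space set \<Rightarrow> ('a \<Rightarrow> real) \<Rightarrow> ereal" where
  "Linf_norm \<Omega> f = esssup (lebesgue_on \<Omega>) (\<lambda>x. ereal \<bar>f x\<bar>)"

definition Linf :: "'a::euclidean_space set \<Rightarrow> ('a \<Rightarrow> real) set" where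
  "Linf \<Omega> = {f \<in> borel_measurable (lebesgue_on \<Omega>). Linf_norm \<Omega> f < \<infinity>}"

definition C1 :: "('a::euclidean_space \<Rightarrow> real) \<Rightarrow> bool" where
  "C1 f \<longleftrightarrow> (\<exists>G. continuous_on UNIV G \<and> (\<forall>x. gderiv f x (G x)))"

text \<open>Test functions are \<open>C\<^sup>1\<close> with compact support. By mollification they give the same weak
  derivatives, and the same space \<open>H\<^sup>1\<^sub>0\<close>, as smooth ones.\<close>

definition test_functions :: "'a::euclidean_space set \<Rightarrow> ('a \<Rightarrow> real) set" where
  "test_functions \<Omega> = {\<phi>. C1 \<phi> \<and> compact (closure {x. \<phi> x \<noteq> 0}) \<and> closure {x. \<phi> x \<noteq> 0} \<subseteq> \<Omega>}"

definition partial_on :: "'a::euclidean_space set \<Rightarrow> 'a \<Rightarrow> ('a \<Rightarrow> real) \<Rightarrow> 'a l2" where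
  "partial_on \<Omega> b \<phi> = l2_on \<Omega> (\<lambda>x. frechet_derivative \<phi> (at x) b)"

definition has_weak_gradient :: "'a::euclidean_space set \<Rightarrow> 'a l2 \<Rightarrow> ('a \<Rightarrow> 'a l2) \<Rightarrow> bool" where
  "has_weak_gradient \<Omega> u w \<longleftrightarrow>
     (\<forall>b\<in>Basis. w b \<in> L2 \<Omega> \<and>
       (\<forall>\<phi>\<in>test_functions \<Omega>. inner u (partial_on \<Omega> b \<phi>) = - inner (w b) (l2_on \<Omega> \<phi>)))"

definition H10 :: "'a::euclidean_space set \<Rightarrow> 'a l2 set" where
  "H10 \<Omega> = {u \<in> L2 \<Omega>. \<exists>w. has_weak_gradient \<Omega> u w \<and>
     (\<exists>\<phi>. (\<forall>n. \<phi> n \<in> test_functions \<Omega>) \<and>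
       ((\<lambda>n::nat. l2_on \<Omega> (\<phi> n)) \<longlonglongrightarrow> u) \<and>
       (\<forall>b\<in>Basis. (\<lambda>n. partial_on \<Omega> b (\<phi> n)) \<longlonglongrightarrow> w b))}"


section \<open>The heat semigroup with homogeneous Dirichlet conditions\<close>

text \<open>The graph of the Dirichlet Laplacian: its domain consists of the \<open>u \<in> H\<^sup>1\<^sub>0(\<Omega>)\<close> whose weak
  Laplacian \<open>f\<close> lies in \<open>L\<^sup>2(\<Omega>)\<close>.\<close>

definition dirichlet_laplacian :: "'a::euclidean_space set \<Rightarrow> ('a l2 \<times> 'a l2) set" where
  "dirichlet_laplacian \<Omega> = {(u, f). u \<in> H10 \<Omega> \<and> f \<in> L2 \<Omega> \<and>
     (\<exists>w. has_weak_gradient \<Omega> u w \<and>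
       (\<forall>\<phi>\<in>test_functions \<Omega>.
         (\<Sum>b\<in>Basis. inner (w b) (partial_on \<Omega> b \<phi>)) = - inner f (l2_on \<Omega> \<phi>)))}"

definition C0_semigroup_on :: "'b::real_normed_vector set \<Rightarrow> (real \<Rightarrow> 'b \<Rightarrow> 'b) \<Rightarrow> bool" where
  "C0_semigroup_on X S \<longleftrightarrow>
     (\<forall>t\<ge>0. (\<forall>u\<in>X. S t u \<in> X) \<and>
        (\<forall>u\<in>X. \<forall>w\<in>X. S t (u + w) = S t u + S t w) \<and>
        (\<forall>c. \<forall>u\<in>X. S t (c *\<^sub>R u) = c *\<^sub>R S t u) \<and>
        (\<exists>K. \<forall>u\<in>X. norm (S t u) \<le> K * norm u)) \<and>
     (\<forall>u\<in>X. S 0 u = u) \<and>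
     (\<forall>s\<ge>0. \<forall>t\<ge>0. \<forall>u\<in>X. S (s + t) u = S s (S t u)) \<and>
     (\<forall>u\<in>X. ((\<lambda>t. S t u) \<longlongrightarrow> u) (at_right 0))"

definition semigroup_generator :: "'b::real_normed_vector set \<Rightarrow> (real \<Rightarrow> 'b \<Rightarrow> 'b) \<Rightarrow> ('b \<times> 'b) set" where
  "semigroup_generator X S =
     {(u, f). u \<in> X \<and> f \<in> X \<and> ((\<lambda>h. (S h u - u) /\<^sub>R h) \<longlongrightarrow> f) (at_right 0)}"

definition dirichlet_heat_semigroup :: "'a::euclidean_space set \<Rightarrow> (real \<Rightarrow> 'a l2 \<Rightarrow> 'a l2) \<Rightarrow> bool" where
  "dirichlet_heat_semigroup \<Omega> S \<longleftrightarrow>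
     C0_semigroup_on (L2 \<Omega>) S \<and> semigroup_generator (L2 \<Omega>) S = dirichlet_laplacian \<Omega>"


section \<open>The domain and the parabolic problem\<close>

text \<open>Near each boundary point, \<open>\<Omega>\<close> is the strict epigraph, in some direction \<open>e\<close>, of a \<open>C\<^sup>1\<close>
  function on the hyperplane orthogonal to \<open>e\<close>. Such a function is the restriction of a \<open>C\<^sup>1\<close>
  function on the whole space (compose it with the orthogonal projection).\<close>

definition C1_boundary :: "'a::euclidean_space set \<Rightarrow> bool" where
  "C1_boundary \<Omega> \<longleftrightarrow>
     (\<forall>p\<in>frontier \<Omega>. \<exists>r>0. \<exists>e \<gamma>. norm e = 1 \<and> C1 \<gamma> \<and>
        \<Omega> \<inter> ball p r = {x \<in> ball p r. \<gamma> (x - (x \<bullet> e) *\<^sub>R e) < x \<bullet> e})"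

definition pp_source :: "real \<Rightarrow> real \<Rightarrow> real \<Rightarrow> real \<Rightarrow> real" where
  "pp_source \<alpha> \<beta> lam r = lam * r powr \<beta> - r powr \<alpha>"

text \<open>A curve \<open>v\<close> in \<open>L\<^sup>2(\<Omega>)\<close> has no canonical pointwise values, so the boundedness on \<open>(0,T) \<times> \<Omega>\<close>
  is stated for a jointly measurable representative \<open>V\<close>. The integral in the mild formulation is
  taken in the Banach space \<open>'a l2\<close>.\<close>

definition pp_solution ::
  "'a::euclidean_space set \<Rightarrow> (real \<Rightarrow> 'a l2 \<Rightarrow> 'a l2) \<Rightarrow> real \<Rightarrow> real \<Rightarrow> real \<Rightarrow>
   ('a \<Rightarrow> real) \<Rightarrow> (real \<Rightarrow> 'a l2) \<Rightarrow> bool" where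
  "pp_solution \<Omega> S \<alpha> \<beta> lam v\<^sub>0 v \<longleftrightarrow>
     (\<forall>t\<ge>0. v t \<in> L2 \<Omega>) \<and> continuous_on {0..} v \<and>
     (\<forall>t\<ge>0. AE x in lebesgue_on \<Omega>. 0 \<le> rep_l2 (v t) x) \<and>
     (\<forall>T>0. \<exists>V \<in> borel_measurable (lebesgue_on ({0<..<T} \<times> \<Omega>)).
        (AE t in lebesgue_on {0<..<T}. AE x in lebesgue_on \<Omega>. V (t, x) = rep_l2 (v t) x) \<and>
        (\<lambda>z. pp_source \<alpha> \<beta> lam (V z)) \<in> Linf ({0<..<T} \<times> \<Omega>)) \<and>
     (\<forall>t\<ge>0. ((\<lambda>s. S (t - s) (l2_on \<Omega> (\<lambda>x. pp_source \<alpha> \<beta> lam (rep_l2 (v s) x))))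
        has_integral (v t - S t (l2_on \<Omega> v\<^sub>0))) {0..t})"

end

theory Submission
  imports Defs
begin

text \<open>Since \<open>\<beta> \<le> 1\<close>, the source \<open>f r = lam * r powr \<beta> - r powr \<alpha>\<close> is one-sided Lipschitz above every
  positive level, and for \<open>M < lam powr (- 1 / (\<beta> - \<alpha>))\<close> it satisfies \<open>f y \<le> - k * y\<close> on \<open>(0, M]\<close>
  with some \<open>k > 0\<close>. Hence \<open>y t = M * exp (- k * t)\<close> is a supersolution which is constant in space,
  and it suffices to show that the positive part of \<open>v t - y t\<close> vanishes.

  Over a short time \<open>h\<close> the mild formulation gives \<open>v (t + h) = S h (v t + h * f (v t))\<close> up to \<open>o(h)\<close>
  in \<open>L\<^sup>2\<close>, uniformly in \<open>t\<close>. The heat semigroup does not increase the \<open>L\<^sup>2\<close> norm of the positive part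
  of \<open>u - c\<close> for constants \<open>c \<ge> 0\<close>, because \<open>\<Delta>u\<close> has a nonpositive inner product with it. So
  \<open>q t\<close>, the norm of the positive part of \<open>v t - y t\<close>, satisfies \<open>q (t + h) \<le> (1 + L * h) * q t + o(h)\<close>,
  and \<open>q 0 = 0\<close>. Summing over a subdivision avoids all differentiability questions.\<close>

subsection \<open>Discrete Gronwall inequality and uniform boundedness\<close>

text \<open>The obstacle is the origin: the slope of \<open>- r powr \<alpha>\<close> tends to minus
  infinity there, so the source is not Lipschitz and an Euler step need not preserve order. The
  source is still uniformly continuous on the half line, with moduli
  \<open>e + C * \<bar>r - s\<bar>\<close> for every \<open>e > 0\<close>. The defect of order is
  then at most \<open>h * e\<close> per step, and letting \<open>e\<close> tend to 0 in the Gronwall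
  inequality removes it. A Lipschitz bound from above is used only at values above the
  supersolution, which on \<open>[0, T]\<close> stays above the positive number
  \<open>M * exp (- k * T)\<close>. The resulting constant \<open>L\<close> may grow with
  \<open>T\<close>; this is harmless because the initial excess is exactly 0.

  The heat semigroup is given only through strong continuity and its generator. Local bounds, the
  density of the domain, the \<open>L2\<close> contraction and the order estimate are all extracted
  from these two properties.\<close>

lemma small_factor:
  fixes a e :: real
  assumes "0 \<le> a" "0 < e" shows "\<exists>d>0. d * a \<le> e"
proof (intro exI[of _ "e / (a + 1)"] conjI)
  show "0 < e / (a + 1)" using assms by simp
  show "e / (a + 1) * a \<le> e" using assms by (simp add: field_simps)
qed

text \<open>No regularity of \<open>q\<close> enters: \<open>[0, T]\<close> is cut into
  \<open>n\<close> equal steps, and the errors \<open>e * h\<close> add up to at most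
  \<open>exp (L * T) * e * T\<close>, where \<open>e\<close> is arbitrary. The point of the
  hypothesis is that \<open>d\<close> may depend on \<open>e\<close> but not on
  \<open>s\<close>.\<close>

lemma discrete_gronwall:
  fixes q :: "real \<Rightarrow> real"
  assumes T: "0 < T" and L: "0 \<le> L"
    and step: "\<And>e. 0 < e \<Longrightarrow> \<exists>d>0. \<forall>h s. 0 < h \<and> h < d \<and> 0 \<le> s \<and> s + h \<le> T \<longrightarrow>
      q (s + h) \<le> (1 + L * h) * q s + e * h"
    and q0: "0 \<le> q 0"
  shows "q T \<le> exp (L * T) * q 0"
proof -
  have *: "q T \<le> exp (L * T) * (q 0 + e * T)" if e: "0 < e" for e
  proof -
    obtain d where d: "d > 0" and stp: "\<And>h s. 0 < h \<Longrightarrow> h < d \<Longrightarrow> 0 \<le> s \<Longrightarrow> s + h \<le> T \<Longrightarrow>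
        q (s + h) \<le> (1 + L * h) * q s + e * h"
      using step[OF e] by blast
    obtain n :: nat where n: "T / d < real n" using reals_Archimedean2 by blast
    have n0: "0 < real n" using n T d by (meson divide_pos_pos less_trans)
    define h where "h = T / real n"
    have h: "0 < h" "h < d" "real n * h = T"
      using n n0 T d by (auto simp: h_def field_simps)
    have "k \<le> n \<Longrightarrow> q (real k * h) \<le> (1 + L * h) ^ k * (q 0 + e * (real k * h))" for k
    proof (induction k)
      case (Suc k)
      have "real (Suc k) * h \<le> real n * h" using Suc.prems h by (intro mult_right_mono) auto
      then have "q (real k * h + h) \<le> (1 + L * h) * q (real k * h) + e * h"
        using h by (intro stp) (auto simp: algebra_simps)
      also have "\<dots> \<le> (1 + L * h) * ((1 + L * h) ^ k * (q 0 + e * (real k * h))) + e * h"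
        using Suc h L by (intro add_right_mono mult_left_mono) auto
      also have "\<dots> \<le> (1 + L * h) ^ Suc k * (q 0 + e * (real k * h)) + (1 + L * h) ^ Suc k * (e * h)"
      proof -
        have "1 \<le> (1 + L * h) ^ Suc k" using h L by (intro one_le_power) simp
        then have "1 * (e * h) \<le> (1 + L * h) ^ Suc k * (e * h)"
          using e h by (intro mult_right_mono) auto
        then show ?thesis by simp
      qed
      also have "\<dots> = (1 + L * h) ^ Suc k * (q 0 + e * (real (Suc k) * h))"
        by (simp add: algebra_simps)
      finally show ?case by (simp add: algebra_simps)
    qed simp
    from this[of n] have "q T \<le> (1 + L * h) ^ n * (q 0 + e * T)" using h by simp
    also have "(1 + L * h) ^ n \<le> exp (L * h) ^ n"
      using h L by (intro power_mono exp_ge_add_one_self) auto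
    also have "exp (L * h) ^ n = exp (L * T)"
      using h by (simp flip: exp_of_nat_mult add: algebra_simps)
    finally show ?thesis using q0 e T by (simp add: mult_right_mono)
  qed
  show ?thesis
  proof (rule field_le_epsilon)
    fix e :: real assume "0 < e"
    then have "0 < e / (exp (L * T) * T)" using T by simp
    from *[OF this] T show "q T \<le> exp (L * T) * q 0 + e" by (simp add: distrib_left)
  qed
qed

text \<open>Baire category: the closed sets \<open>C m\<close> cover the complete space, so one of
  them contains a ball. Linearity moves that ball to the origin by subtracting its centre, which
  costs the factor 2.\<close>

lemma uniform_boundedness:
  fixes A :: "nat \<Rightarrow> 'b::banach \<Rightarrow> 'c::real_normed_vector"
  assumes lin: "\<And>n. bounded_linear (A n)" and bdd: "\<And>u. bounded (range (\<lambda>n. A n u))"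
  shows "\<exists>K. \<forall>n u. norm (A n u) \<le> K * norm u"
proof -
  define C where "C m = {u. \<forall>n. norm (A n u) \<le> real m}" for m
  have clC: "closed (C m)" for m
  proof -
    have "continuous_on UNIV (A n)" for n
      using lin[of n] by (simp add: linear_continuous_on)
    then have "closed {u. norm (A n u) \<le> real m}" for n
      by (intro closed_Collect_le continuous_intros)
    then have "closed (\<Inter>n. {u. norm (A n u) \<le> real m})" by blast
    moreover have "C m = (\<Inter>n. {u. norm (A n u) \<le> real m})" by (auto simp: C_def)
    ultimately show ?thesis by simp
  qed
  have "\<exists>m. interior (C m) \<noteq> {}"
  proof (rule ccontr)
    assume "\<not> ?thesis"
    then have "euclidean interior_of (\<Union>(range C)) = {}"
      using clC by (intro Baire_category_alt) (auto simp: completely_metrizable_space_euclidean)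
    moreover have "\<Union>(range C) = UNIV"
    proof (intro set_eqI iffI UNIV_I)
      fix u
      obtain B where "\<And>n. norm (A n u) \<le> B" using bdd[of u] by (auto simp: bounded_iff)
      moreover obtain m :: nat where "B \<le> real m" using real_arch_simple by blast
      ultimately show "u \<in> \<Union>(range C)" unfolding C_def by (auto intro: order_trans)
    qed
    ultimately show False by simp
  qed
  then obtain m u0 where "u0 \<in> interior (C m)" by blast
  then obtain r where r: "r > 0" "cball u0 r \<subseteq> C m"
    using mem_interior_cball by blast
  have "norm (A n u) \<le> (2 * real m / r) * norm u" for n u
  proof (cases "u = 0")
    case True
    then show ?thesis using bounded_linear.linear[OF lin] linear_0 by fastforce
  next
    case False
    interpret bounded_linear "A n" by (rule lin)
    define w where "w = (r / norm u) *\<^sub>R u"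
    have "norm w = r" using False r by (simp add: w_def)
    then have "u0 + w \<in> C m" "u0 \<in> C m" using r by (auto simp: dist_norm)
    then have "norm (A n (u0 + w)) \<le> real m" "norm (A n u0) \<le> real m" by (auto simp: C_def)
    moreover have "A n w = A n (u0 + w) - A n u0" by (simp add: add)
    ultimately have "norm (A n w) \<le> 2 * real m"
      using norm_triangle_ineq4[of "A n (u0 + w)" "A n u0"] by simp
    then show ?thesis using False r by (simp add: w_def scaleR field_simps)
  qed
  then show ?thesis by blast
qed

subsection \<open>Strongly continuous semigroups\<close>

text \<open>The semigroup is constrained only on the subspace \<open>X\<close>, whereas bounded
  linear maps are defined on the whole type. Composing with a bounded projection \<open>P\<close>
  onto \<open>X\<close> makes \<open>S t\<close> total, so that limits and integrals can be passed
  through it; membership in \<open>X\<close> becomes the equation \<open>P u = u\<close>.\<close>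

locale c0_semigroup =
  fixes X :: "'b::banach set" and S :: "real \<Rightarrow> 'b \<Rightarrow> 'b" and P :: "'b \<Rightarrow> 'b"
  assumes C0: "C0_semigroup_on X S"
    and P_linear: "bounded_linear P" and P_in: "\<And>u. P u \<in> X" and P_id: "\<And>u. u \<in> X \<Longrightarrow> P u = u"
begin

lemma S_in: "0 \<le> t \<Longrightarrow> u \<in> X \<Longrightarrow> S t u \<in> X"
  and S_add: "0 \<le> t \<Longrightarrow> u \<in> X \<Longrightarrow> w \<in> X \<Longrightarrow> S t (u + w) = S t u + S t w"
  and S_scale: "0 \<le> t \<Longrightarrow> u \<in> X \<Longrightarrow> S t (c *\<^sub>R u) = c *\<^sub>R S t u"
  and S_0: "u \<in> X \<Longrightarrow> S 0 u = u"
  and S_plus: "0 \<le> s \<Longrightarrow> 0 \<le> t \<Longrightarrow> u \<in> X \<Longrightarrow> S (s + t) u = S s (S t u)"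
  and S_tendsto: "u \<in> X \<Longrightarrow> ((\<lambda>t. S t u) \<longlongrightarrow> u) (at_right 0)"
  and S_bounded: "0 \<le> t \<Longrightarrow> \<exists>K. \<forall>u\<in>X. norm (S t u) \<le> K * norm u"
  using C0 unfolding C0_semigroup_on_def by blast+

lemma X_add: "u \<in> X \<Longrightarrow> w \<in> X \<Longrightarrow> u + w \<in> X"
  by (metis P_in P_id P_linear linear_add bounded_linear.linear)

lemma X_scale: "u \<in> X \<Longrightarrow> c *\<^sub>R u \<in> X"
  by (metis P_in P_id P_linear linear_scale bounded_linear.linear)

lemma X_diff: "u \<in> X \<Longrightarrow> w \<in> X \<Longrightarrow> u - w \<in> X"
  by (metis P_in P_id P_linear linear_diff bounded_linear.linear)

lemma SP_linear:
  assumes "0 \<le> t" shows "bounded_linear (\<lambda>u. S t (P u))"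
proof -
  obtain K where K: "\<forall>u\<in>X. norm (S t u) \<le> K * norm u" using S_bounded[OF assms] by blast
  have "bounded_linear P" by (rule P_linear)
  then interpret P: bounded_linear P .
  obtain B where B: "\<And>u. norm (P u) \<le> norm u * B" using P.bounded by blast
  show ?thesis
  proof (rule bounded_linear_intro)
    fix u w :: 'b and c :: real
    show "S t (P (u + w)) = S t (P u) + S t (P w)" by (simp add: P.add S_add assms P_in)
    show "S t (P (c *\<^sub>R u)) = c *\<^sub>R S t (P u)" by (simp add: P.scaleR S_scale assms P_in)
    have "norm (S t (P u)) \<le> K * norm (P u)" using K P_in by blast
    also have "\<dots> \<le> \<bar>K\<bar> * norm (P u)" by (intro mult_right_mono) auto
    also have "\<dots> \<le> \<bar>K\<bar> * (norm u * B)" using B by (intro mult_left_mono) auto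
    finally show "norm (S t (P u)) \<le> norm u * (\<bar>K\<bar> * B)" by (simp add: algebra_simps)
  qed
qed

lemma S_diff: "0 \<le> t \<Longrightarrow> u \<in> X \<Longrightarrow> w \<in> X \<Longrightarrow> S t (u - w) = S t u - S t w"
  using linear_diff[OF bounded_linear.linear[OF SP_linear], of t u w] by (simp add: P_id X_diff)

text \<open>Otherwise there are times \<open>t n\<close> tending to 0 at which the operator norm
  exceeds \<open>n\<close>. Strong continuity at 0 bounds every single orbit along these times,
  which contradicts uniform boundedness.\<close>

lemma S_locally_bounded: "\<exists>d>0. \<exists>K. \<forall>t u. 0 \<le> t \<and> t \<le> d \<and> u \<in> X \<longrightarrow> norm (S t u) \<le> K * norm u"
proof (rule ccontr)
  assume C: "\<not> ?thesis"
  have "\<exists>t u. 0 \<le> t \<and> t \<le> 1 / real (Suc n) \<and> u \<in> X \<and> norm (S t u) > real n * norm u" for n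
  proof (rule ccontr)
    assume "\<not> ?thesis"
    then have "\<forall>t u. 0 \<le> t \<and> t \<le> 1 / real (Suc n) \<and> u \<in> X \<longrightarrow> norm (S t u) \<le> real n * norm u"
      by (meson not_le)
    then show False
      using C by (metis of_nat_0_less_iff zero_less_Suc zero_less_divide_1_iff)
  qed
  then obtain t u where tu: "\<And>n. 0 \<le> t n" "\<And>n. t n \<le> 1 / real (Suc n)" "\<And>n. u n \<in> X"
      "\<And>n. norm (S (t n) (u n)) > real n * norm (u n)" by metis
  have "bounded (range (\<lambda>n. S (t n) (P w)))" for w
  proof -
    have "((\<lambda>t. S t (P w)) \<longlongrightarrow> P w) (at_right 0)" by (rule S_tendsto[OF P_in])
    then have "eventually (\<lambda>t. dist (S t (P w)) (P w) < 1) (at_right 0)"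
      by (rule tendstoD) simp
    then obtain b where b: "b > 0" "\<And>t. 0 < t \<Longrightarrow> t < b \<Longrightarrow> dist (S t (P w)) (P w) < 1"
      unfolding eventually_at_right_field by blast
    then have b': "dist (S t (P w)) (P w) < 1" if "0 \<le> t" "t < b" for t
      using that S_0[OF P_in] by (cases "t = 0") auto
    obtain N :: nat where N: "1 / b < real N" using reals_Archimedean2 by blast
    have "dist (S (t n) (P w)) (P w) < 1" if "n \<ge> N" for n
    proof (rule b'[OF tu(1)])
      have "1 / b < real (Suc n)" using N that by simp
      then have "1 / real (Suc n) < b" using b(1) by (simp add: field_simps)
      then show "t n < b" using tu(2)[of n] by simp
    qed
    then have "(\<lambda>n. S (t n) (P w)) ` {N..} \<subseteq> ball (P w) 1" by (auto simp: dist_commute)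
    then have 1: "bounded ((\<lambda>n. S (t n) (P w)) ` {N..})" using bounded_ball bounded_subset by blast
    have "bounded ((\<lambda>n. S (t n) (P w)) ` {..<N})" by (intro finite_imp_bounded) simp
    with 1 have "bounded ((\<lambda>n. S (t n) (P w)) ` {N..} \<union> (\<lambda>n. S (t n) (P w)) ` {..<N})" by simp
    then show ?thesis by (rule bounded_subset) (use linorder_not_less in auto)
  qed
  then obtain K where K: "\<And>n w. norm (S (t n) (P w)) \<le> K * norm w"
    using uniform_boundedness[of "\<lambda>n w. S (t n) (P w)"] SP_linear tu(1) by blast
  obtain n :: nat where "K \<le> real n" using real_arch_simple by blast
  then have "K * norm (u n) \<le> real n * norm (u n)" by (rule mult_right_mono) simp
  then show False using K[of n "u n"] tu(4)[of n] P_id[OF tu(3)] by simp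
qed

lemma S_bounded_on: "\<exists>K\<ge>1. \<forall>t u. 0 \<le> t \<and> t \<le> T \<and> u \<in> X \<longrightarrow> norm (S t u) \<le> K * norm u"
proof -
  obtain d K where d: "d > 0" and K: "\<And>t u. 0 \<le> t \<Longrightarrow> t \<le> d \<Longrightarrow> u \<in> X \<Longrightarrow> norm (S t u) \<le> K * norm u"
    using S_locally_bounded by blast
  define M where "M = max 1 K"
  have M: "norm (S t u) \<le> M * norm u" if "0 \<le> t" "t \<le> d" "u \<in> X" for t u
  proof -
    have "K * norm u \<le> M * norm u" unfolding M_def by (intro mult_right_mono) auto
    then show ?thesis using K[OF that] by simp
  qed
  have M1: "1 \<le> M" by (simp add: M_def)
  have *: "0 \<le> t \<and> t \<le> real n * d \<and> u \<in> X \<longrightarrow> norm (S t u) \<le> M ^ n * norm u" for n t u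
  proof (induction n arbitrary: t u)
    case 0
    then show ?case using S_0 by (cases "t = 0") auto
  next
    case (Suc n)
    show ?case
    proof (intro impI, elim conjE)
      assume t: "0 \<le> t" "t \<le> real (Suc n) * d" and u: "u \<in> X"
      show "norm (S t u) \<le> M ^ Suc n * norm u"
      proof (cases "t \<le> d")
        case True
        then have "norm (S t u) \<le> M ^ 1 * norm u" using M t u by simp
        also have "\<dots> \<le> M ^ Suc n * norm u"
          using M1 by (intro mult_right_mono power_increasing) auto
        finally show ?thesis .
      next
        case False
        then have "S t u = S d (S (t - d) u)" using S_plus[of d "t - d" u] d u by simp
        moreover have "norm (S d (S (t - d) u)) \<le> M * norm (S (t - d) u)"
          using False d u by (intro M S_in) auto
        moreover have "norm (S (t - d) u) \<le> M ^ n * norm u"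
          using Suc.IH[of "t - d" u] False t u by (simp add: algebra_simps)
        then have "M * norm (S (t - d) u) \<le> M * (M ^ n * norm u)"
          using M1 by (intro mult_left_mono) auto
        ultimately show ?thesis by (simp add: algebra_simps)
      qed
    qed
  qed
  obtain n :: nat where "T / d \<le> real n" using real_arch_simple by blast
  then have "T \<le> real n * d" using d by (simp add: field_simps)
  moreover have "1 \<le> M ^ n" using M1 by (rule one_le_power)
  ultimately show ?thesis using * by (intro exI[of _ "M ^ n"]) (auto intro: order_trans)
qed

lemma S_near_0:
  assumes "u \<in> X" "0 < e"
  shows "\<exists>d>0. \<forall>h. 0 \<le> h \<and> h < d \<longrightarrow> norm (S h u - u) < e"
proof -
  have "eventually (\<lambda>t. dist (S t u) u < e) (at_right 0)"
    using S_tendsto[OF assms(1)] assms(2) by (rule tendstoD)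
  then obtain b where b: "b > 0" "\<And>t. 0 < t \<Longrightarrow> t < b \<Longrightarrow> dist (S t u) u < e"
    unfolding eventually_at_right_field by blast
  then have "norm (S t u - u) < e" if "0 \<le> t" "t < b" for t
    using that S_0[OF assms(1)] assms(2) by (cases "t = 0") (auto simp: dist_norm)
  with b(1) show ?thesis by blast
qed

lemma S_increment:
  assumes "0 \<le> s" "0 \<le> h" "u \<in> X"
  shows "S (s + h) u - S s u = S s (S h u - u)"
  using assms by (simp add: S_plus S_diff S_in)

lemma S_continuous:
  assumes u: "u \<in> X" shows "continuous_on {0..} (\<lambda>t. S t u)"
proof (rule continuous_on_iff[THEN iffD2], intro ballI allI impI)
  fix t e :: real assume t: "t \<in> {0..}" and e: "0 < e"
  obtain K where K: "K \<ge> 1" "\<And>s w. 0 \<le> s \<Longrightarrow> s \<le> t + 1 \<Longrightarrow> w \<in> X \<Longrightarrow> norm (S s w) \<le> K * norm w"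
    using S_bounded_on[of "t + 1"] by blast
  have "0 < e / K" using e K by simp
  then obtain d where d: "d > 0" "\<And>h. 0 \<le> h \<Longrightarrow> h < d \<Longrightarrow> norm (S h u - u) < e / K"
    using S_near_0[OF u] by blast
  \<comment> \<open>Only right continuity at 0 is given. Factoring out the semigroup at the earlier
    of the two times reduces both one-sided limits to it, the factor being bounded by
    \<open>K\<close> on \<open>[0, t + 1]\<close>.\<close>
  have main: "dist (S r u) (S s u) < e" if "0 \<le> s" "s \<le> r" "r - s < d" "r \<le> t + 1" for r s
  proof -
    have "S r u - S s u = S s (S (r - s) u - u)" using S_increment[of s "r - s" u] that u by simp
    moreover have "norm (S s (S (r - s) u - u)) \<le> K * norm (S (r - s) u - u)"
      using that u by (intro K X_diff S_in) auto
    moreover have "K * norm (S (r - s) u - u) < K * (e / K)"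
      using d(2)[of "r - s"] that K(1) by (intro mult_strict_left_mono) auto
    ultimately show ?thesis using K(1) by (simp add: dist_norm)
  qed
  show "\<exists>d>0. \<forall>x'\<in>{0..}. dist x' t < d \<longrightarrow> dist (S x' u) (S t u) < e"
  proof (intro exI[of _ "min d 1"] conjI ballI impI)
    fix r :: real assume r: "r \<in> {0..}" "dist r t < min d 1"
    show "dist (S r u) (S t u) < e"
    proof (cases "t \<le> r")
      case True
      then show ?thesis using main[of t r] r t by (auto simp: dist_real_def)
    next
      case False
      then show ?thesis using main[of r t] r t by (auto simp: dist_real_def dist_commute)
    qed
  qed (use d in auto)
qed

lemma generator_invariant:
  assumes "(u, f) \<in> semigroup_generator X S" and t: "0 \<le> t"
  shows "(S t u, S t f) \<in> semigroup_generator X S"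
proof -
  have u: "u \<in> X" "f \<in> X" and lim: "((\<lambda>h. (S h u - u) /\<^sub>R h) \<longlongrightarrow> f) (at_right 0)"
    using assms(1) by (auto simp: semigroup_generator_def)
  have "((\<lambda>h. S t (P ((S h u - u) /\<^sub>R h))) \<longlongrightarrow> S t (P f)) (at_right 0)"
    by (rule bounded_linear.tendsto[OF SP_linear[OF t] lim])
  moreover have "eventually (\<lambda>h. S t (P ((S h u - u) /\<^sub>R h)) = (S h (S t u) - S t u) /\<^sub>R h) (at_right 0)"
  proof (rule eventually_at_right_less[THEN eventually_mono])
    fix h :: real assume "0 < h"
    moreover have "S t (S h u) = S h (S t u)" if "0 < h"
      using S_plus[of t h u] S_plus[of h t u] that t u by (simp add: add.commute)
    ultimately show "S t (P ((S h u - u) /\<^sub>R h)) = (S h (S t u) - S t u) /\<^sub>R h"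
      using t u by (simp add: P_id S_scale X_scale X_diff S_in S_diff)
  qed
  ultimately have "((\<lambda>h. (S h (S t u) - S t u) /\<^sub>R h) \<longlongrightarrow> S t (P f)) (at_right 0)"
    by (rule Lim_transform_eventually)
  then show ?thesis using t u by (simp add: semigroup_generator_def S_in P_id)
qed

text \<open>The averages \<open>F t /\<^sub>R t\<close> of the orbit converge to \<open>u\<close>.
  They lie in the domain because shifting the integral gives
  \<open>S h (F t) - F t = (F (t + h) - F t) - F h\<close>, whose quotient by \<open>h\<close> tends
  to \<open>S t u - u\<close>.\<close>

lemma generator_domain_dense:
  assumes u: "u \<in> X"
  shows "u \<in> closure (Domain (semigroup_generator X S))"
proof -
  define F where "F t = integral {0..t} (\<lambda>s. S s u)" for t
  have int: "(\<lambda>s. S s u) integrable_on {a..b}" if "0 \<le> a" for a b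
    using that S_continuous[OF u]
    by (intro integrable_continuous_real) (auto elim: continuous_on_subset)
  have SPF: "S h (P (F t)) = F (t + h) - F h" if h: "0 \<le> h" "0 \<le> t" for h t
  proof -
    have "S h (P (F t)) = integral {0..t} (\<lambda>s. S h (P (S s u)))"
      unfolding F_def using integral_linear[OF int SP_linear[OF h(1)], of 0 t] by (simp add: o_def)
    also have "\<dots> = integral {0..t} (\<lambda>s. S (s + h) u)"
      using u h by (intro integral_cong) (simp add: P_id S_in S_plus[symmetric] add.commute)
    also have "\<dots> = integral {h..t + h} (\<lambda>s. S s u)"
      by (rule integral_shift_real_ivl[of h h "t + h" "\<lambda>s. S s u",
          unfolded diff_self add_diff_cancel_right'])
    also have "\<dots> = F (t + h) - F h"
      using Henstock_Kurzweil_Integration.integral_combine[of 0 h "t + h" "\<lambda>s. S s u"] int[of 0] h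
      by (simp add: F_def algebra_simps)
    finally show ?thesis .
  qed
  have F_in: "F t \<in> X" if "0 \<le> t" for t
  proof -
    have "P (F t) = integral {0..t} (\<lambda>s. P (S s u))"
      unfolding F_def using integral_linear[OF int P_linear, of 0 t] by (simp add: o_def)
    also have "\<dots> = F t" unfolding F_def
      using u by (intro integral_cong) (simp add: P_id S_in)
    finally show ?thesis by (metis P_in)
  qed
  have F0: "F 0 = 0" by (simp add: F_def)
  have deriv: "((\<lambda>h. (F (t + h) - F t) /\<^sub>R h) \<longlongrightarrow> S t u) (at_right 0)" if t: "0 \<le> t" for t
  proof -
    have "(F has_vector_derivative S t u) (at t within {0..t + 1})"
      unfolding F_def using t S_continuous[OF u]
      by (intro integral_has_vector_derivative) (auto elim: continuous_on_subset)
    then have "(F has_vector_derivative S t u) (at t within {t..t + 1})"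
      using t by (elim has_vector_derivative_within_subset) auto
    then have "((\<lambda>y. (1 / norm (y - t)) *\<^sub>R (F y - (F t + (y - t) *\<^sub>R S t u))) \<longlongrightarrow> 0) (at_right t)"
      by (simp add: has_vector_derivative_def has_derivative_within at_within_Icc_at_right)
    moreover have "eventually (\<lambda>y. (1 / norm (y - t)) *\<^sub>R (F y - (F t + (y - t) *\<^sub>R S t u))
        = (F y - F t) /\<^sub>R (y - t) - S t u) (at_right t)"
      by (intro eventually_at_right_less[THEN eventually_mono])
        (simp add: scaleR_diff_right scaleR_add_right divide_inverse)
    ultimately have "((\<lambda>y. (F y - F t) /\<^sub>R (y - t) - S t u) \<longlongrightarrow> 0) (at_right t)"
      by (rule Lim_transform_eventually)
    then have "((\<lambda>y. (F y - F t) /\<^sub>R (y - t)) \<longlongrightarrow> S t u) (at_right t)"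
      by (rule LIM_zero_cancel)
    then show ?thesis
      unfolding filterlim_at_right_to_0[of _ _ t] by (simp add: add.commute)
  qed
  have dom: "F t \<in> Domain (semigroup_generator X S)" if t: "0 \<le> t" for t
  proof -
    have "((\<lambda>h. (F (t + h) - F t) /\<^sub>R h - (F (0 + h) - F 0) /\<^sub>R h) \<longlongrightarrow> S t u - S 0 u) (at_right 0)"
      using t by (intro tendsto_diff deriv) auto
    moreover have "eventually (\<lambda>h. (F (t + h) - F t) /\<^sub>R h - (F (0 + h) - F 0) /\<^sub>R h
        = (S h (F t) - F t) /\<^sub>R h) (at_right 0)"
    proof (rule eventually_at_right_less[THEN eventually_mono])
      fix h :: real assume "0 < h"
      then have "S h (F t) = F (t + h) - F h" using SPF[of h t] t P_id[OF F_in[OF t]] by simp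
      then show "(F (t + h) - F t) /\<^sub>R h - (F (0 + h) - F 0) /\<^sub>R h = (S h (F t) - F t) /\<^sub>R h"
        by (simp add: F0 flip: scaleR_diff_right)
    qed
    ultimately have "((\<lambda>h. (S h (F t) - F t) /\<^sub>R h) \<longlongrightarrow> S t u - S 0 u) (at_right 0)"
      by (rule Lim_transform_eventually)
    then have "(F t, S t u - S 0 u) \<in> semigroup_generator X S"
      using t u by (simp add: semigroup_generator_def F_in X_diff S_in)
    then show ?thesis by blast
  qed
  have scale: "F t /\<^sub>R t \<in> Domain (semigroup_generator X S)" if t: "0 < t" for t
  proof -
    obtain f where f: "F t \<in> X" "f \<in> X" "((\<lambda>h. (S h (F t) - F t) /\<^sub>R h) \<longlongrightarrow> f) (at_right 0)"
      using dom[of t] t by (auto simp: semigroup_generator_def)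
    have "((\<lambda>h. inverse t *\<^sub>R ((S h (F t) - F t) /\<^sub>R h)) \<longlongrightarrow> inverse t *\<^sub>R f) (at_right 0)"
      using f(3) by (intro tendsto_intros)
    moreover have "eventually (\<lambda>h. inverse t *\<^sub>R ((S h (F t) - F t) /\<^sub>R h)
        = (S h (F t /\<^sub>R t) - F t /\<^sub>R t) /\<^sub>R h) (at_right 0)"
      using f by (intro eventually_at_right_less[THEN eventually_mono])
        (simp add: S_scale scaleR_diff_right mult.commute)
    ultimately have "((\<lambda>h. (S h (F t /\<^sub>R t) - F t /\<^sub>R t) /\<^sub>R h) \<longlongrightarrow> inverse t *\<^sub>R f) (at_right 0)"
      by (rule Lim_transform_eventually)
    then have "(F t /\<^sub>R t, inverse t *\<^sub>R f) \<in> semigroup_generator X S"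
      using f by (simp add: semigroup_generator_def X_scale)
    then show ?thesis by blast
  qed
  have "((\<lambda>h. F h /\<^sub>R h) \<longlongrightarrow> u) (at_right 0)"
    using deriv[of 0] u by (simp add: F0 S_0)
  moreover have "eventually (\<lambda>h. F h /\<^sub>R h \<in> closure (Domain (semigroup_generator X S))) (at_right 0)"
    using scale closure_subset by (intro eventually_at_right_less[THEN eventually_mono]) blast
  ultimately show ?thesis
    by (intro Lim_in_closed_set[where f = "\<lambda>h. F h /\<^sub>R h" and F = "at_right 0"]) auto
qed

end

text \<open>The one-sided expansion of \<open>J\<close> replaces its derivative along a trajectory, which is only known
  to be differentiable from the right.\<close>

lemma (in c0_semigroup) functional_nonincreasing:
  fixes J :: "'b \<Rightarrow> real" and \<Phi> :: "'b \<Rightarrow> 'b" and B :: "'b \<Rightarrow> 'b \<Rightarrow> real"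
  assumes expand: "\<And>u w. u \<in> X \<Longrightarrow> w \<in> X \<Longrightarrow> J w \<le> J u + B u (w - u) + (norm (w - u))\<^sup>2"
    and B_add: "\<And>u w z. u \<in> X \<Longrightarrow> w \<in> X \<Longrightarrow> z \<in> X \<Longrightarrow> B u (w + z) = B u w + B u z"
    and B_scale: "\<And>u w c. u \<in> X \<Longrightarrow> w \<in> X \<Longrightarrow> B u (c *\<^sub>R w) = c * B u w"
    and B_bound: "\<And>u w. u \<in> X \<Longrightarrow> w \<in> X \<Longrightarrow> B u w \<le> C * norm u * norm w" and C: "0 \<le> C"
    and diss: "\<And>u f. (u, f) \<in> semigroup_generator X S \<Longrightarrow> B u f \<le> 0"
    and J: "continuous_on X J" "\<And>u. 0 \<le> J u"
    and t: "0 < t" and u: "u \<in> X"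
  shows "J (S t u) \<le> J u"
proof -
  obtain K where K: "K \<ge> 1" "\<And>s w. 0 \<le> s \<Longrightarrow> s \<le> t \<Longrightarrow> w \<in> X \<Longrightarrow> norm (S s w) \<le> K * norm w"
    using S_bounded_on[of t] by blast
  have dom: "J (S t u) \<le> J u" if u_dom: "u \<in> Domain (semigroup_generator X S)" for u
  proof -
    obtain f where uf: "(u, f) \<in> semigroup_generator X S" using u_dom by blast
    then have u: "u \<in> X" "f \<in> X" and lim: "((\<lambda>h. (S h u - u) /\<^sub>R h) \<longlongrightarrow> f) (at_right 0)"
      by (auto simp: semigroup_generator_def)
    \<comment> \<open>Gronwall with growth rate 0. In the bounds below, \<open>A * e1\<close>
      controls the contribution of the error in the difference quotient and \<open>D\<close> the
      squared increment divided by the square of \<open>h\<close>; each receives half of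
      \<open>e\<close>.\<close>
    have "J (S t u) \<le> exp (0 * t) * J (S 0 u)"
    proof (rule discrete_gronwall[where q = "\<lambda>s. J (S s u)", OF t order_refl])
      fix e :: real assume e: "0 < e"
      define A where "A = C * (K * norm u) * K"
      have A: "0 \<le> A" unfolding A_def using C K by simp
      define e1 where "e1 = min 1 (e / (2 * (A + 1)))"
      have e1: "0 < e1" "e1 \<le> 1" "A * e1 \<le> e / 2"
      proof -
        show "0 < e1" "e1 \<le> 1" using e A by (auto simp: e1_def)
        have "A * e1 \<le> A * (e / (2 * (A + 1)))" unfolding e1_def using A by (intro mult_left_mono) auto
        also have "\<dots> \<le> e / 2" using A e by (simp add: field_simps)
        finally show "A * e1 \<le> e / 2" .
      qed
      define D where "D = (K * (norm f + 1))\<^sup>2"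
      have D: "0 \<le> D" by (simp add: D_def)
      obtain d where d: "d > 0" "\<And>h. 0 < h \<Longrightarrow> h < d \<Longrightarrow> dist ((S h u - u) /\<^sub>R h) f < e1"
        using tendstoD[OF lim e1(1)] unfolding eventually_at_right_field by blast
      show "\<exists>d>0. \<forall>h s. 0 < h \<and> h < d \<and> 0 \<le> s \<and> s + h \<le> t \<longrightarrow>
          J (S (s + h) u) \<le> (1 + 0 * h) * J (S s u) + e * h"
      proof (intro exI[of _ "min d (e / (2 * (D + 1)))"] conjI allI impI)
        show "0 < min d (e / (2 * (D + 1)))" using d e D by simp
      next
        fix h s :: real
        assume "0 < h \<and> h < min d (e / (2 * (D + 1))) \<and> 0 \<le> s \<and> s + h \<le> t"
        then have h: "0 < h" "h < d" "h < e / (2 * (D + 1))" and s: "0 \<le> s" "s + h \<le> t" by auto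
        define r where "r = (S h u - u) /\<^sub>R h - f"
        have r: "norm r < e1" using d(2)[OF h(1,2)] by (simp add: r_def dist_norm)
        have rX: "r \<in> X" using u h unfolding r_def by (intro X_diff X_scale S_in) auto
        define us where "us = S s u"
        have us: "us \<in> X" "norm us \<le> K * norm u" using u s h unfolding us_def by (auto intro!: S_in K)
        have inc: "S h u - u = h *\<^sub>R (f + r)" using h by (simp add: r_def)
        \<comment> \<open>The quotient error \<open>r\<close> is measured once, at time 0, and
          transported by \<open>S s\<close>. Hence the admissible step size does not depend on
          \<open>s\<close>.\<close>
        have diff: "S (s + h) u - us = h *\<^sub>R (S s f + S s r)"
          using S_increment[of s h u] s h u rX by (simp add: us_def inc S_scale S_add X_add)
        have sX: "S s f \<in> X" "S s r \<in> X" using s u rX by (auto intro: S_in)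
        have nr: "norm (S s r) \<le> K * e1" using K(2)[of s r] K(1) s h rX r
          by (smt (verit) mult_left_mono)
        have "(us, S s f) \<in> semigroup_generator X S"
          unfolding us_def by (rule generator_invariant[OF uf s(1)])
        then have "B us (S s f) \<le> 0" by (rule diss)
        moreover have "B us (S s r) \<le> e / 2"
        proof -
          have "B us (S s r) \<le> C * norm us * norm (S s r)" by (intro B_bound us sX)
          also have "\<dots> \<le> C * (K * norm u) * (K * e1)"
            using C us nr K(1) by (intro mult_mono) auto
          also have "\<dots> = A * e1" by (simp add: A_def)
          finally show ?thesis using e1 by simp
        qed
        ultimately have "B us (S s f + S s r) \<le> e / 2" using B_add[OF us(1) sX] by simp
        then have 1: "B us (h *\<^sub>R (S s f + S s r)) \<le> h * (e / 2)"
          using B_scale[OF us(1) X_add[OF sX]] h by (simp add: mult_left_mono)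
        have "norm (S s f + S s r) \<le> K * norm f + K * 1"
        proof -
          have "norm (S s f) \<le> K * norm f" using K s h u by auto
          moreover have "K * e1 \<le> K * 1" using e1 K(1) by (intro mult_left_mono) auto
          ultimately show ?thesis using nr norm_triangle_ineq[of "S s f" "S s r"] by linarith
        qed
        then have "(norm (S s f + S s r))\<^sup>2 \<le> D"
          unfolding D_def by (intro power_mono) (auto simp: algebra_simps)
        then have "h * (h * (norm (S s f + S s r))\<^sup>2) \<le> h * (h * (D + 1))"
          using h by (intro mult_left_mono) auto
        also have "\<dots> \<le> h * (e / 2)"
          using h D by (intro mult_left_mono) (auto simp: field_simps)
        finally have 2: "(norm (S (s + h) u - us))\<^sup>2 \<le> h * (e / 2)"
          unfolding diff using h by (simp add: power2_eq_square ac_simps)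
        have "J (S (s + h) u) \<le> J us + B us (S (s + h) u - us) + (norm (S (s + h) u - us))\<^sup>2"
          using u s h by (intro expand us S_in) auto
        also have "\<dots> \<le> J us + e * h" using 1[folded diff] 2 by (simp add: algebra_simps)
        finally show "J (S (s + h) u) \<le> (1 + 0 * h) * J (S s u) + e * h" by (simp add: us_def)
      qed
    qed (use J in auto)
    then show ?thesis using S_0 u by simp
  qed
  \<comment> \<open>The estimate on the domain extends to \<open>X\<close> by density, since both
    \<open>J\<close> and \<open>S t\<close> are continuous.\<close>
  obtain w where w: "\<And>n. w n \<in> Domain (semigroup_generator X S)" "w \<longlonglongrightarrow> u"
    using generator_domain_dense[OF u] unfolding closure_sequential by blast
  have wX: "w n \<in> X" for n using w(1) by (auto simp: semigroup_generator_def)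
  have "(\<lambda>n. J (w n)) \<longlonglongrightarrow> J u"
    using wX u by (intro continuous_on_tendsto_compose[OF J(1) w(2)]) auto
  moreover have "(\<lambda>n. S t (w n)) \<longlonglongrightarrow> S t u"
    using bounded_linear.tendsto[OF SP_linear w(2), of t] t wX u by (simp add: P_id)
  then have "(\<lambda>n. J (S t (w n))) \<longlonglongrightarrow> J (S t u)"
    using wX u t by (intro continuous_on_tendsto_compose[OF J(1)]) (simp_all add: S_in)
  ultimately show ?thesis
    by (intro LIMSEQ_le) (auto intro: dom w)
qed

subsection \<open>Superposition operators on square integrable functions\<close>

lemma rep_l2_measurable [measurable]: "rep_l2 u \<in> borel_measurable lebesgue"
  using square_integrable_rep_l2[of u] by (simp add: square_integrable_def)

lemma rep_l2_add: "AE x in lebesgue. rep_l2 (u + w) x = rep_l2 u x + rep_l2 w x"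
proof -
  have "u + w = abs_l2 (\<lambda>x. rep_l2 u x + rep_l2 w x)"
    using plus_l2.abs_eq[of "rep_l2 u" "rep_l2 w"]
    by (simp add: abs_rep_l2 l2rel_def square_integrable_rep_l2)
  then show ?thesis
    using rep_abs_l2[OF square_integrable_add[OF square_integrable_rep_l2 square_integrable_rep_l2]]
    by simp
qed

lemma rep_l2_scaleR: "AE x in lebesgue. rep_l2 (c *\<^sub>R u) x = c * rep_l2 u x"
proof -
  have "c *\<^sub>R u = abs_l2 (\<lambda>x. c * rep_l2 u x)"
    using scaleR_l2.abs_eq[of "rep_l2 u" c]
    by (simp add: abs_rep_l2 l2rel_def square_integrable_rep_l2)
  then show ?thesis
    using rep_abs_l2[OF square_integrable_scale[OF square_integrable_rep_l2]] by simp
qed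

lemma rep_l2_diff: "AE x in lebesgue. rep_l2 (u - w) x = rep_l2 u x - rep_l2 w x"
proof -
  have "AE x in lebesgue. rep_l2 (u + (-1) *\<^sub>R w) x = rep_l2 u x - rep_l2 w x"
    using rep_l2_add[of u "(-1) *\<^sub>R w"] rep_l2_scaleR[of "-1" w] by eventually_elim simp
  then show ?thesis by simp
qed

lemma inner_l2_rep: "inner u w = (\<integral>x. rep_l2 u x * rep_l2 w x \<partial>lebesgue)"
  using inner_l2.abs_eq[of "rep_l2 u" "rep_l2 w"]
  by (simp add: abs_rep_l2 l2rel_def square_integrable_rep_l2)

lemma l2_eqI:
  assumes "AE x in lebesgue. rep_l2 u x = rep_l2 w x" shows "u = w"
  using abs_l2_eqI[OF square_integrable_rep_l2 square_integrable_rep_l2 assms]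
  by (simp add: abs_rep_l2)

lemma norm_l2_mono:
  assumes "AE x in lebesgue. \<bar>rep_l2 u x\<bar> \<le> \<bar>rep_l2 w x\<bar>"
  shows "norm u \<le> norm w"
proof -
  have "(norm u)\<^sup>2 \<le> (norm w)\<^sup>2"
    unfolding power2_norm_eq_inner inner_l2_rep
  proof (intro integral_mono_AE square_integrable_mult square_integrable_rep_l2)
    show "AE x in lebesgue. rep_l2 u x * rep_l2 u x \<le> rep_l2 w x * rep_l2 w x"
      using assms by eventually_elim (simp add: abs_le_square_iff power2_eq_square)
  qed
  then show ?thesis by (rule power2_le_imp_le) simp
qed

lemma inner_l2_nonneg:
  assumes "AE x in lebesgue. 0 \<le> rep_l2 u x * rep_l2 w x" shows "0 \<le> inner u w"
  unfolding inner_l2_rep by (rule integral_nonneg_AE[OF assms])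

locale bounded_open_set =
  fixes \<Omega> :: "'a::euclidean_space set"
  assumes open_\<Omega>: "open \<Omega>" and bounded_\<Omega>: "bounded \<Omega>"
begin

lemma \<Omega>_lebesgue [measurable]: "\<Omega> \<in> sets lebesgue"
  using open_\<Omega> by simp

lemma emeasure_\<Omega>: "emeasure lebesgue \<Omega> < \<infinity>"
  using emeasure_bounded_finite[OF bounded_\<Omega>] open_\<Omega> by simp

lemma square_integrable_bounded:
  assumes [measurable]: "g \<in> borel_measurable lebesgue"
    and bnd: "AE x in lebesgue. x \<in> \<Omega> \<longrightarrow> \<bar>g x\<bar> \<le> a"
  shows "square_integrable (\<lambda>x. if x \<in> \<Omega> then g x else 0)"
  unfolding square_integrable_def
proof
  show "integrable lebesgue (\<lambda>x. (if x \<in> \<Omega> then g x else 0)\<^sup>2)"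
  proof (rule Bochner_Integration.integrable_bound)
    show "integrable lebesgue (\<lambda>x. a\<^sup>2 * indicator \<Omega> x)"
      using emeasure_\<Omega> by (intro integrable_mult_right integrable_real_indicator) auto
    show "AE x in lebesgue. norm ((if x \<in> \<Omega> then g x else 0)\<^sup>2) \<le> norm (a\<^sup>2 * indicator \<Omega> x)"
      using bnd by eventually_elim (auto simp: abs_le_square_iff[symmetric] indicator_def)
  qed simp
qed simp

lemma square_integrable_growth:
  assumes [measurable]: "g \<in> borel_measurable lebesgue"
    and bnd: "AE x in lebesgue. x \<in> \<Omega> \<longrightarrow> \<bar>g x\<bar> \<le> a + b * \<bar>rep_l2 u x\<bar>"
  shows "square_integrable (\<lambda>x. if x \<in> \<Omega> then g x else 0)"
  unfolding square_integrable_def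
proof
  have sq: "square_integrable (\<lambda>x. if x \<in> \<Omega> then \<bar>a\<bar> else 0)"
    by (rule square_integrable_bounded) auto
  have "square_integrable (\<lambda>x. (if x \<in> \<Omega> then \<bar>a\<bar> else 0) + \<bar>b * rep_l2 u x\<bar>)"
  proof (rule square_integrable_add[OF sq])
    show "square_integrable (\<lambda>x. \<bar>b * rep_l2 u x\<bar>)"
      using square_integrable_scale[OF square_integrable_rep_l2[of u], of b]
      by (auto simp: square_integrable_def)
  qed
  then have int: "integrable lebesgue (\<lambda>x. ((if x \<in> \<Omega> then \<bar>a\<bar> else 0) + \<bar>b * rep_l2 u x\<bar>)\<^sup>2)"
    by (simp add: square_integrable_def)
  show "integrable lebesgue (\<lambda>x. (if x \<in> \<Omega> then g x else 0)\<^sup>2)"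
  proof (rule Bochner_Integration.integrable_bound[OF int])
    show "AE x in lebesgue. norm ((if x \<in> \<Omega> then g x else 0)\<^sup>2)
        \<le> norm (((if x \<in> \<Omega> then \<bar>a\<bar> else 0) + \<bar>b * rep_l2 u x\<bar>)\<^sup>2)"
      using bnd
    proof eventually_elim
      case (elim x)
      have "b * \<bar>rep_l2 u x\<bar> \<le> \<bar>b * rep_l2 u x\<bar>"
        by (simp add: abs_mult mult_right_mono)
      then show ?case using elim by (auto simp: abs_le_square_iff[symmetric])
    qed
  qed simp
qed simp

abbreviation one_\<Omega> :: "'a l2" where "one_\<Omega> \<equiv> l2_on \<Omega> (\<lambda>x. 1)"

lemma rep_l2_on:
  "square_integrable (\<lambda>x. if x \<in> \<Omega> then g x else 0) \<Longrightarrow>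
    AE x in lebesgue. rep_l2 (l2_on \<Omega> g) x = (if x \<in> \<Omega> then g x else 0)"
  unfolding l2_on_def by (rule rep_abs_l2)

lemma l2_on_in_L2:
  assumes "square_integrable (\<lambda>x. if x \<in> \<Omega> then g x else 0)" shows "l2_on \<Omega> g \<in> L2 \<Omega>"
  unfolding L2_def using rep_l2_on[OF assms] by (simp, eventually_elim) simp

lemma L2_vanish: "u \<in> L2 \<Omega> \<Longrightarrow> AE x in lebesgue. x \<notin> \<Omega> \<longrightarrow> rep_l2 u x = 0"
  by (simp add: L2_def)

lemma rep_one: "AE x in lebesgue. rep_l2 one_\<Omega> x = (if x \<in> \<Omega> then 1 else 0)"
  by (intro rep_l2_on square_integrable_bounded[where a = 1]) auto

text \<open>Converts pointwise moduli of continuity into norm estimates. The additive constant costs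
  only a multiple of the norm of the indicator of \<Omega>, which is finite because \<Omega> is
  bounded.\<close>

lemma norm_l2_le_affine:
  assumes "0 \<le> e" "0 \<le> C"
    and dom: "AE x in lebesgue. \<bar>rep_l2 z x\<bar> \<le> (if x \<in> \<Omega> then e else 0) + C * \<bar>rep_l2 w x\<bar>"
  shows "norm z \<le> e * norm one_\<Omega> + C * norm w"
proof -
  have sq: "square_integrable (\<lambda>x. \<bar>rep_l2 w x\<bar>)"
    using square_integrable_rep_l2[of w] by (auto simp: square_integrable_def)
  define A where "A = abs_l2 (\<lambda>x. \<bar>rep_l2 w x\<bar>)"
  have A: "AE x in lebesgue. rep_l2 A x = \<bar>rep_l2 w x\<bar>"
    unfolding A_def by (rule rep_abs_l2[OF sq])
  have "norm z \<le> norm (e *\<^sub>R one_\<Omega> + C *\<^sub>R A)"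
  proof (rule norm_l2_mono)
    show "AE x in lebesgue. \<bar>rep_l2 z x\<bar> \<le> \<bar>rep_l2 (e *\<^sub>R one_\<Omega> + C *\<^sub>R A) x\<bar>"
      using dom A rep_l2_add[of "e *\<^sub>R one_\<Omega>" "C *\<^sub>R A"] rep_l2_scaleR[of e one_\<Omega>]
        rep_l2_scaleR[of C A] rep_one
    proof eventually_elim
      case (elim x)
      then have "rep_l2 (e *\<^sub>R one_\<Omega> + C *\<^sub>R A) x = (if x \<in> \<Omega> then e else 0) + C * \<bar>rep_l2 w x\<bar>"
        by simp
      with elim(1) show ?case by linarith
    qed
  qed
  also have "\<dots> \<le> e * norm one_\<Omega> + C * norm A"
    using norm_triangle_ineq[of "e *\<^sub>R one_\<Omega>" "C *\<^sub>R A"] assms by simp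
  also have "norm A \<le> norm w" by (rule norm_l2_mono, use A in eventually_elim) simp
  then have "e * norm one_\<Omega> + C * norm A \<le> e * norm one_\<Omega> + C * norm w"
    using assms by (simp add: mult_left_mono)
  finally show ?thesis .
qed

definition proj :: "'a l2 \<Rightarrow> 'a l2" where "proj u = l2_on \<Omega> (rep_l2 u)"

lemma square_integrable_proj: "square_integrable (\<lambda>x. if x \<in> \<Omega> then rep_l2 u x else 0)"
  by (rule square_integrable_growth[where a = 0 and b = 1]) auto

lemma rep_proj: "AE x in lebesgue. rep_l2 (proj u) x = (if x \<in> \<Omega> then rep_l2 u x else 0)"
  unfolding proj_def by (intro rep_l2_on square_integrable_proj)

lemma proj_in: "proj u \<in> L2 \<Omega>"
  unfolding proj_def by (intro l2_on_in_L2 square_integrable_proj)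

lemma proj_id:
  assumes "u \<in> L2 \<Omega>" shows "proj u = u"
  by (rule l2_eqI, use rep_proj[of u] L2_vanish[OF assms] in eventually_elim) auto

lemma proj_linear: "bounded_linear proj"
proof (rule bounded_linear_intro)
  show "proj (u + w) = proj u + proj w" for u w
    by (rule l2_eqI, use rep_proj[of u] rep_proj[of w] rep_proj[of "u + w"] rep_l2_add[of u w]
        rep_l2_add[of "proj u" "proj w"] in eventually_elim) auto
  show "proj (c *\<^sub>R u) = c *\<^sub>R proj u" for c u
    by (rule l2_eqI, use rep_proj[of u] rep_proj[of "c *\<^sub>R u"] rep_l2_scaleR[of c u]
        rep_l2_scaleR[of c "proj u"] in eventually_elim) auto
  have "norm (proj u) \<le> norm u" for u
    by (rule norm_l2_mono, use rep_proj[of u] in eventually_elim) auto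
  then show "norm (proj u) \<le> norm u * 1" for u by simp
qed

definition superpos :: "(real \<Rightarrow> real) \<Rightarrow> 'a l2 \<Rightarrow> 'a l2" where
  "superpos F u = l2_on \<Omega> (\<lambda>x. F (rep_l2 u x))"

text \<open>Linear growth is enough for square integrability on a set of finite measure, and
  measurability of \<open>F\<close> makes the composition with a Lebesgue measurable representative
  measurable.\<close>

definition admissible :: "(real \<Rightarrow> real) \<Rightarrow> bool" where
  "admissible F \<longleftrightarrow> F \<in> borel_measurable borel \<and> (\<exists>a b. \<forall>r. \<bar>F r\<bar> \<le> a + b * \<bar>r\<bar>)"

lemma square_integrable_superpos:
  assumes "admissible F" shows "square_integrable (\<lambda>x. if x \<in> \<Omega> then F (rep_l2 u x) else 0)"
proof -
  obtain a b where ab: "\<And>r. \<bar>F r\<bar> \<le> a + b * \<bar>r\<bar>" and [measurable]: "F \<in> borel_measurable borel"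
    using assms by (auto simp: admissible_def)
  show ?thesis
    by (rule square_integrable_growth[where a = a and b = b and u = u]) (use ab in auto)
qed

lemma rep_superpos:
  "admissible F \<Longrightarrow>
    AE x in lebesgue. rep_l2 (superpos F u) x = (if x \<in> \<Omega> then F (rep_l2 u x) else 0)"
  unfolding superpos_def by (intro rep_l2_on square_integrable_superpos)

lemma superpos_in: "admissible F \<Longrightarrow> superpos F u \<in> L2 \<Omega>"
  unfolding superpos_def by (intro l2_on_in_L2 square_integrable_superpos)

lemma norm_superpos_diff:
  assumes F: "admissible F" "0 \<le> e" "0 \<le> C"
    and u: "AE x in lebesgue. x \<in> \<Omega> \<longrightarrow> rep_l2 u x \<in> R" and w: "AE x in lebesgue. x \<in> \<Omega> \<longrightarrow> rep_l2 w x \<in> R"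
    and lip: "\<And>r s. r \<in> R \<Longrightarrow> s \<in> R \<Longrightarrow> \<bar>F r - F s\<bar> \<le> e + C * \<bar>r - s\<bar>"
  shows "norm (superpos F u - superpos F w) \<le> e * norm one_\<Omega> + C * norm (u - w)"
proof (rule norm_l2_le_affine[OF F(2,3)])
  show "AE x in lebesgue. \<bar>rep_l2 (superpos F u - superpos F w) x\<bar>
      \<le> (if x \<in> \<Omega> then e else 0) + C * \<bar>rep_l2 (u - w) x\<bar>"
    using rep_superpos[OF F(1), of u] rep_superpos[OF F(1), of w] rep_l2_diff[of u w] u w
      rep_l2_diff[of "superpos F u" "superpos F w"]
  proof eventually_elim
    case (elim x)
    then show ?case using lip[of "rep_l2 u x" "rep_l2 w x"] F by auto
  qed
qed

end

subsection \<open>The heat semigroup preserves upper bounds\<close>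

context bounded_open_set
begin

lemma test_functions_gradient:
  assumes "\<phi> \<in> test_functions \<Omega>"
  obtains G where "continuous_on UNIV G" "\<And>x. (\<phi> has_derivative (\<lambda>h. h \<bullet> G x)) (at x)"
    "\<And>x b. frechet_derivative \<phi> (at x) b = b \<bullet> G x"
proof -
  obtain G where G: "continuous_on UNIV G" "\<And>x. (\<phi> has_derivative (\<lambda>h. h \<bullet> G x)) (at x)"
    using assms by (auto simp: test_functions_def C1_def gderiv_def)
  then show ?thesis using that frechet_derivative_at[OF G(2)] by metis
qed

lemma square_integrable_continuous:
  fixes g :: "'a \<Rightarrow> real"
  assumes "continuous_on UNIV g"
  shows "square_integrable (\<lambda>x. if x \<in> \<Omega> then g x else 0)"
proof -
  have "compact (g ` closure \<Omega>)"
    using bounded_\<Omega> continuous_on_subset[OF assms]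
    by (intro compact_continuous_image) auto
  then have "bounded (g ` closure \<Omega>)" by (rule compact_imp_bounded)
  then obtain a where "\<And>x. x \<in> closure \<Omega> \<Longrightarrow> \<bar>g x\<bar> \<le> a"
    unfolding bounded_iff by (metis imageI real_norm_def)
  then show ?thesis
    using closure_subset[of \<Omega>] borel_measurable_continuous_onI[OF assms]
    by (intro square_integrable_bounded[where a = a]) (auto intro: measurable_completion)
qed

lemma rep_test_function:
  assumes "\<phi> \<in> test_functions \<Omega>"
  shows "AE x in lebesgue. rep_l2 (l2_on \<Omega> \<phi>) x = (if x \<in> \<Omega> then \<phi> x else 0)"
proof -
  obtain G where "\<And>x. (\<phi> has_derivative (\<lambda>h. h \<bullet> G x)) (at x)"
    using test_functions_gradient[OF assms] by metis
  then have "continuous_on UNIV \<phi>"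
    by (meson continuous_at_imp_continuous_on has_derivative_continuous)
  then show ?thesis by (intro rep_l2_on square_integrable_continuous)
qed

lemma rep_partial:
  assumes "\<phi> \<in> test_functions \<Omega>"
  shows "AE x in lebesgue. rep_l2 (partial_on \<Omega> b \<phi>) x
    = (if x \<in> \<Omega> then frechet_derivative \<phi> (at x) b else 0)"
proof -
  obtain G where G: "continuous_on UNIV G" "\<And>x b. frechet_derivative \<phi> (at x) b = b \<bullet> G x"
    using test_functions_gradient[OF assms] by metis
  show ?thesis unfolding partial_on_def using G(1)
    by (intro rep_l2_on square_integrable_continuous) (simp add: G(2), intro continuous_intros)
qed

text \<open>The class of \<open>C1\<close> test functions is stable under composition with a
  function that is itself only \<open>C1\<close>; \<open>\<Phi> 0 = 0\<close> keeps the support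
  inside \<Omega>.\<close>

lemma test_functions_chain:
  assumes \<phi>: "\<phi> \<in> test_functions \<Omega>"
    and \<Phi>: "\<And>r. (\<Phi> has_real_derivative \<Phi>' r) (at r)" "continuous_on UNIV \<Phi>'" "\<Phi> 0 = 0"
  shows "(\<lambda>x. \<Phi> (\<phi> x)) \<in> test_functions \<Omega>"
    and "frechet_derivative (\<lambda>x. \<Phi> (\<phi> x)) (at x) b = \<Phi>' (\<phi> x) * frechet_derivative \<phi> (at x) b"
proof -
  obtain G where G: "continuous_on UNIV G" "\<And>x. (\<phi> has_derivative (\<lambda>h. h \<bullet> G x)) (at x)"
    "\<And>x b. frechet_derivative \<phi> (at x) b = b \<bullet> G x"
    using test_functions_gradient[OF \<phi>] by metis
  have "((\<lambda>x. \<Phi> (\<phi> x)) has_derivative (\<lambda>h. \<Phi>' (\<phi> x) * (h \<bullet> G x))) (at x)" for x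
    using has_derivative_compose[OF G(2) \<Phi>(1)[unfolded has_field_derivative_def]] by simp
  then have D: "((\<lambda>x. \<Phi> (\<phi> x)) has_derivative (\<lambda>h. h \<bullet> (\<Phi>' (\<phi> x) *\<^sub>R G x))) (at x)" for x
    by simp
  have "continuous_on UNIV \<phi>"
    using G(2) by (meson continuous_at_imp_continuous_on has_derivative_continuous)
  then have "continuous_on UNIV (\<lambda>x. \<Phi>' (\<phi> x))"
    by (intro continuous_on_compose2[OF \<Phi>(2)]) auto
  then have "continuous_on UNIV (\<lambda>x. \<Phi>' (\<phi> x) *\<^sub>R G x)" using G(1) by (intro continuous_intros)
  then have "C1 (\<lambda>x. \<Phi> (\<phi> x))" using D by (auto simp: C1_def gderiv_def)
  moreover have sub: "closure {x. \<Phi> (\<phi> x) \<noteq> 0} \<subseteq> closure {x. \<phi> x \<noteq> 0}"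
    using \<Phi>(3) by (intro closure_mono) auto
  moreover have "compact (closure {x. \<phi> x \<noteq> 0} \<inter> closure {x. \<Phi> (\<phi> x) \<noteq> 0})"
    using \<phi> by (intro compact_Int_closed) (auto simp: test_functions_def)
  then have "compact (closure {x. \<Phi> (\<phi> x) \<noteq> 0})" using sub by (simp add: Int_absorb1)
  ultimately show "(\<lambda>x. \<Phi> (\<phi> x)) \<in> test_functions \<Omega>" using \<phi> by (auto simp: test_functions_def)
  show "frechet_derivative (\<lambda>x. \<Phi> (\<phi> x)) (at x) b = \<Phi>' (\<phi> x) * frechet_derivative \<phi> (at x) b"
    using fun_cong[OF frechet_derivative_at[OF D], of b] by (simp add: G(3))
qed

end

locale dirichlet_semigroup = bounded_open_set \<Omega> for \<Omega> :: "'a::euclidean_space set" +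
  fixes S :: "real \<Rightarrow> 'a l2 \<Rightarrow> 'a l2"
  assumes heat: "dirichlet_heat_semigroup \<Omega> S"

sublocale dirichlet_semigroup \<subseteq> c0_semigroup "L2 \<Omega>" S proj
proof (rule c0_semigroup.intro)
  show "C0_semigroup_on (L2 \<Omega>) S" using heat by (simp add: dirichlet_heat_semigroup_def)
qed (use proj_linear proj_in proj_id in blast)+

context dirichlet_semigroup
begin

lemma generator: "semigroup_generator (L2 \<Omega>) S = dirichlet_laplacian \<Omega>"
  using heat by (simp add: dirichlet_heat_semigroup_def)

text \<open>The density of the test functions is inherited from that of the domain of the generator.\<close>

lemma orthogonal_test_functions:
  assumes g: "g \<in> L2 \<Omega>" and orth: "\<And>\<phi>. \<phi> \<in> test_functions \<Omega> \<Longrightarrow> inner g (l2_on \<Omega> \<phi>) = 0"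
  shows "g = 0"
proof -
  have cl: "closed {z. inner g z = 0}" by (intro closed_Collect_eq continuous_intros)
  have "z \<in> {z. inner g z = 0}" if z: "z \<in> H10 \<Omega>" for z
  proof -
    obtain \<phi> where \<phi>: "\<And>n::nat. \<phi> n \<in> test_functions \<Omega>"
      and lim: "(\<lambda>n. l2_on \<Omega> (\<phi> n)) \<longlonglongrightarrow> z"
      using z by (auto simp: H10_def)
    then show ?thesis using closed_sequentially[OF cl _ lim] orth[OF \<phi>] by simp
  qed
  then have "Domain (dirichlet_laplacian \<Omega>) \<subseteq> {z. inner g z = 0}"
    by (auto simp: dirichlet_laplacian_def)
  then have "closure (Domain (dirichlet_laplacian \<Omega>)) \<subseteq> {z. inner g z = 0}"
    using cl by (rule closure_minimal)
  then have "inner g g = 0" using generator_domain_dense[OF g] by (auto simp: generator)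
  then show ?thesis by simp
qed

text \<open>\<open>H10\<close> and \<open>dirichlet_laplacian\<close> each assert the existence of a
  weak gradient. The one that is a limit of gradients of test functions must be identified with the
  one in the weak formulation of the Laplacian.\<close>

lemma weak_gradient_unique:
  assumes "has_weak_gradient \<Omega> u w" "has_weak_gradient \<Omega> u w'" and b: "b \<in> Basis"
  shows "w b = w' b"
proof -
  have wb: "w b \<in> L2 \<Omega>" "w' b \<in> L2 \<Omega>"
    and eq: "\<And>\<phi>. \<phi> \<in> test_functions \<Omega> \<Longrightarrow> inner (w b) (l2_on \<Omega> \<phi>) = inner (w' b) (l2_on \<Omega> \<phi>)"
    using assms by (force simp: has_weak_gradient_def)+
  have "w b - w' b = 0"
    using wb by (intro orthogonal_test_functions X_diff) (simp_all add: inner_diff_left eq)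
  then show ?thesis by simp
qed

text \<open>Formally the left-hand side is minus the integral of \<open>\<Phi>' u\<close> times the
  squared gradient of \<open>u\<close>. The gradient of \<open>superpos \<Phi> u\<close> is never
  computed: the test functions \<open>\<Phi> (\<phi> n x)\<close> are inserted into the weak
  formulation, and only their zeroth order convergence is used.\<close>

lemma laplacian_dissipative_C1:
  assumes uf: "(u, f) \<in> dirichlet_laplacian \<Omega>"
    and \<Phi>: "\<And>r. (\<Phi> has_real_derivative \<Phi>' r) (at r)" "continuous_on UNIV \<Phi>'" "\<Phi> 0 = 0"
    and \<Phi>': "\<And>r. 0 \<le> \<Phi>' r" "\<And>r. \<Phi>' r \<le> 1"
  shows "inner (superpos \<Phi> u) f \<le> 0"
proof -
  have lip: "\<bar>\<Phi> r - \<Phi> s\<bar> \<le> \<bar>r - s\<bar>" for r s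
    using field_differentiable_bound[of UNIV \<Phi> \<Phi>' 1 r s] \<Phi>(1) \<Phi>' by simp
  have "continuous_on UNIV \<Phi>"
    using \<Phi>(1) by (meson DERIV_isCont continuous_at_imp_continuous_on)
  moreover have "\<bar>\<Phi> r\<bar> \<le> 0 + 1 * \<bar>r\<bar>" for r using lip[of r 0] \<Phi>(3) by simp
  ultimately have adm: "admissible \<Phi>"
    unfolding admissible_def by (blast intro: borel_measurable_continuous_onI)
  obtain w' where w': "has_weak_gradient \<Omega> u w'"
    "\<And>\<phi>. \<phi> \<in> test_functions \<Omega> \<Longrightarrow>
      (\<Sum>b\<in>Basis. inner (w' b) (partial_on \<Omega> b \<phi>)) = - inner f (l2_on \<Omega> \<phi>)"
    using uf by (auto simp: dirichlet_laplacian_def)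
  obtain w \<phi> where w: "has_weak_gradient \<Omega> u w" and \<phi>: "\<And>n::nat. \<phi> n \<in> test_functions \<Omega>"
    and lim: "(\<lambda>n. l2_on \<Omega> (\<phi> n)) \<longlonglongrightarrow> u"
      "\<And>b. b \<in> Basis \<Longrightarrow> (\<lambda>n. partial_on \<Omega> b (\<phi> n)) \<longlonglongrightarrow> w b"
  proof -
    have "u \<in> H10 \<Omega>" using uf by (simp add: dirichlet_laplacian_def)
    then show thesis unfolding H10_def using that by blast
  qed
  have ww': "w' b = w b" if "b \<in> Basis" for b
    by (rule weak_gradient_unique[OF w'(1) w that])
  define \<psi> where "\<psi> n x = \<Phi> (\<phi> n x)" for n x
  have \<psi>: "\<psi> n \<in> test_functions \<Omega>"
    "frechet_derivative (\<psi> n) (at x) b = \<Phi>' (\<phi> n x) * frechet_derivative (\<phi> n) (at x) b" for n x b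
    using test_functions_chain[OF \<phi> \<Phi>] unfolding \<psi>_def by auto
  define p where "p b n = partial_on \<Omega> b (\<phi> n)" for b n
  define q where "q b n = partial_on \<Omega> b (\<psi> n)" for b n
  have q_le: "norm (q b n) \<le> norm (p b n)" for b n
  proof (rule norm_l2_mono)
    show "AE x in lebesgue. \<bar>rep_l2 (q b n) x\<bar> \<le> \<bar>rep_l2 (p b n) x\<bar>"
      unfolding p_def q_def using rep_partial[OF \<phi>[of n], of b] rep_partial[OF \<psi>(1)[of n], of b]
    proof eventually_elim
      case (elim x)
      then show ?case using \<Phi>' by (simp add: \<psi>(2) abs_mult mult_left_le_one_le)
    qed
  qed
  have pq: "0 \<le> inner (p b n) (q b n)" for b n
  proof (rule inner_l2_nonneg)
    show "AE x in lebesgue. 0 \<le> rep_l2 (p b n) x * rep_l2 (q b n) x"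
      unfolding p_def q_def using rep_partial[OF \<phi>[of n], of b] rep_partial[OF \<psi>(1)[of n], of b]
    proof eventually_elim
      case (elim x)
      then show ?case using \<Phi>' by (simp add: \<psi>(2) mult.left_commute)
    qed
  qed
  \<comment> \<open>Replacing \<open>w b\<close> by \<open>p b n\<close> makes each inner product
    with \<open>q b n\<close> nonnegative. The replacement costs the right-hand side, which tends to
    0 because \<open>q b n\<close> is dominated in norm by the convergent
    \<open>p b n\<close>.\<close>
  have *: "inner (l2_on \<Omega> (\<psi> n)) f \<le> (\<Sum>b\<in>Basis. norm (w b - p b n) * norm (p b n))" for n
  proof -
    have "- norm (w b - p b n) * norm (p b n) \<le> inner (w b) (q b n)" for b
    proof -
      have "\<bar>inner (w b - p b n) (q b n)\<bar> \<le> norm (w b - p b n) * norm (q b n)"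
        by (rule Cauchy_Schwarz_ineq2)
      also have "\<dots> \<le> norm (w b - p b n) * norm (p b n)"
        by (intro mult_left_mono q_le) auto
      finally show ?thesis using pq[of b n] by (simp add: inner_diff_left)
    qed
    then have "(\<Sum>b\<in>Basis. - norm (w b - p b n) * norm (p b n)) \<le> (\<Sum>b\<in>Basis. inner (w b) (q b n))"
      by (intro sum_mono)
    also have "\<dots> = - inner f (l2_on \<Omega> (\<psi> n))"
      using w'(2)[OF \<psi>(1)] by (simp add: ww' q_def)
    finally show ?thesis by (simp add: sum_negf inner_commute)
  qed
  have eq: "l2_on \<Omega> (\<psi> n) = superpos \<Phi> (l2_on \<Omega> (\<phi> n))" for n
    by (rule l2_eqI, use rep_test_function[OF \<psi>(1)[of n]] rep_test_function[OF \<phi>[of n]]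
        rep_superpos[OF adm, of "l2_on \<Omega> (\<phi> n)"] in eventually_elim) (simp add: \<psi>_def)
  have "(\<lambda>n. superpos \<Phi> (l2_on \<Omega> (\<phi> n)) - superpos \<Phi> u) \<longlonglongrightarrow> 0"
  proof (rule Lim_null_comparison[OF always_eventually tendsto_norm_zero[OF LIM_zero[OF lim(1)]]], intro allI)
    show "norm (superpos \<Phi> (l2_on \<Omega> (\<phi> n)) - superpos \<Phi> u) \<le> norm (l2_on \<Omega> (\<phi> n) - u)" for n
      using norm_superpos_diff[OF adm, of 0 1 "l2_on \<Omega> (\<phi> n)" UNIV u] lip by simp
  qed
  then have "(\<lambda>n. l2_on \<Omega> (\<psi> n)) \<longlonglongrightarrow> superpos \<Phi> u" unfolding eq by (rule LIM_zero_cancel)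
  then have "(\<lambda>n. inner (l2_on \<Omega> (\<psi> n)) f) \<longlonglongrightarrow> inner (superpos \<Phi> u) f"
    by (intro tendsto_intros)
  moreover have "(\<lambda>n. \<Sum>b\<in>Basis. norm (w b - p b n) * norm (p b n)) \<longlonglongrightarrow> (\<Sum>b\<in>Basis. norm (w b - w b) * norm (w b))"
    unfolding p_def by (intro tendsto_intros lim)
  ultimately show ?thesis using * by (intro LIMSEQ_le) auto
qed

end

text \<open>Taylor remainder of a function whose derivative \<open>2 * max 0 (s - k)\<close> is
  Lipschitz with constant 2. It yields differentiability at the kink as well.\<close>

lemma pos_part_square_remainder:
  fixes r s k :: real
  shows "\<bar>(max 0 (r - k))\<^sup>2 - (max 0 (s - k))\<^sup>2 - 2 * max 0 (s - k) * (r - s)\<bar> \<le> (r - s)\<^sup>2"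
proof -
  consider "k \<le> r" "k \<le> s" | "k \<le> r" "s \<le> k" | "r \<le> k" "k \<le> s" | "r \<le> k" "s \<le> k" by linarith
  then show ?thesis
  proof cases
    case 1
    then have "(max 0 (r - k))\<^sup>2 - (max 0 (s - k))\<^sup>2 - 2 * max 0 (s - k) * (r - s) = (r - s)\<^sup>2"
      by (simp add: power2_eq_square algebra_simps)
    then show ?thesis by simp
  next
    case 2
    then have "(r - k)\<^sup>2 \<le> (r - s)\<^sup>2" by (intro power_mono) auto
    then show ?thesis using 2 by simp
  next
    case 3
    then have "0 - (max 0 (s - k))\<^sup>2 - 2 * max 0 (s - k) * (r - s) = (r - s)\<^sup>2 - (k - r)\<^sup>2"
      by (simp add: power2_eq_square algebra_simps)
    moreover have "(k - r)\<^sup>2 \<le> (s - r)\<^sup>2" using 3 by (intro power_mono) auto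
    ultimately show ?thesis using 3 by (simp add: power2_commute[of s r])
  next
    case 4
    then show ?thesis by simp
  qed
qed

lemma DERIV_pos_part_square:
  fixes k :: real
  shows "((\<lambda>r. (max 0 (r - k))\<^sup>2) has_real_derivative 2 * max 0 (r - k)) (at r)"
  unfolding has_field_derivative_iff
proof (rule LIM_zero_cancel, rule Lim_null_comparison)
  show "((\<lambda>s. \<bar>s - r\<bar>) \<longlongrightarrow> 0) (at r)" by (intro tendsto_eq_intros) auto
  have "norm (((max 0 (s - k))\<^sup>2 - (max 0 (r - k))\<^sup>2) / (s - r) - 2 * max 0 (r - k)) \<le> \<bar>s - r\<bar>"
    if "s \<noteq> r" for s
  proof -
    have "\<bar>(max 0 (s - k))\<^sup>2 - (max 0 (r - k))\<^sup>2 - 2 * max 0 (r - k) * (s - r)\<bar> / \<bar>s - r\<bar> \<le> \<bar>s - r\<bar>\<^sup>2 / \<bar>s - r\<bar>"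
      using pos_part_square_remainder[of s k r] by (intro divide_right_mono) auto
    moreover have "((max 0 (s - k))\<^sup>2 - (max 0 (r - k))\<^sup>2) / (s - r) - 2 * max 0 (r - k)
       = ((max 0 (s - k))\<^sup>2 - (max 0 (r - k))\<^sup>2 - 2 * max 0 (r - k) * (s - r)) / (s - r)"
      using that by (simp add: diff_divide_distrib)
    moreover have "\<bar>s - r\<bar>\<^sup>2 / \<bar>s - r\<bar> = \<bar>s - r\<bar>"
      unfolding power2_eq_square by (rule nonzero_mult_div_cancel_right) (use that in simp)
    ultimately show ?thesis by (simp only: real_norm_def abs_divide)
  qed
  then show "\<forall>\<^sub>F s in at r. norm (((max 0 (s - k))\<^sup>2 - (max 0 (r - k))\<^sup>2) / (s - r) - 2 * max 0 (r - k)) \<le> \<bar>s - r\<bar>"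
    by (simp add: eventually_at_filter)
qed

context dirichlet_semigroup
begin

lemma admissible_pos_part: "admissible (\<lambda>r. max 0 (r - k))"
  unfolding admissible_def
proof (intro conjI exI allI)
  show "\<bar>max 0 (r - k)\<bar> \<le> \<bar>k\<bar> + 1 * \<bar>r\<bar>" for r by auto
qed simp

lemma superpos_id: "u \<in> L2 \<Omega> \<Longrightarrow> superpos (\<lambda>r. r) u = u"
  using proj_id[of u] by (simp add: superpos_def proj_def)

lemma laplacian_dissipative:
  assumes "(u, f) \<in> dirichlet_laplacian \<Omega>" shows "inner u f \<le> 0"
proof -
  have "u \<in> L2 \<Omega>" using assms by (auto simp: dirichlet_laplacian_def H10_def)
  moreover have "inner (superpos (\<lambda>r. r) u) f \<le> 0"
    by (rule laplacian_dissipative_C1[OF assms, where \<Phi>' = "\<lambda>_. 1"]) auto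
  ultimately show ?thesis by (simp add: superpos_id)
qed

text \<open>The truncation \<open>r \<mapsto> max 0 (r - k)\<close> is approximated uniformly by the \<open>C\<^sup>1\<close> functions
  \<open>r \<mapsto> sqrt ((max 0 (r - k))\<^sup>2 + e\<^sup>2) - e\<close>.\<close>

lemma laplacian_dissipative_pos_part:
  assumes uf: "(u, f) \<in> dirichlet_laplacian \<Omega>" and k: "0 \<le> k"
  shows "inner (superpos (\<lambda>r. max 0 (r - k)) u) f \<le> 0"
proof (rule field_le_epsilon)
  fix d :: real assume d: "0 < d"
  \<comment> \<open>A uniform error \<open>e\<close> in the truncation changes the inner product by
    at most \<open>e * A = d\<close>; adding 1 keeps the denominator of \<open>e\<close>
    positive.\<close>
  define A where "A = norm one_\<Omega> * norm f + 1"
  have A: "0 < A" unfolding A_def by (simp add: add_nonneg_pos)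
  define e where "e = d / A"
  have e: "0 < e" using d A by (simp add: e_def)
  define \<Phi> where "\<Phi> r = sqrt ((max 0 (r - k))\<^sup>2 + e\<^sup>2) - e" for r
  define \<Phi>' where "\<Phi>' r = max 0 (r - k) / sqrt ((max 0 (r - k))\<^sup>2 + e\<^sup>2)" for r
  have pos: "0 < (max 0 (r - k))\<^sup>2 + e\<^sup>2" for r using e by (simp add: add_nonneg_pos)
  have D: "(\<Phi> has_real_derivative \<Phi>' r) (at r)" for r
  proof -
    have "((\<lambda>r. (max 0 (r - k))\<^sup>2 + e\<^sup>2) has_real_derivative 2 * max 0 (r - k) + 0) (at r)"
      by (rule DERIV_add[OF DERIV_pos_part_square DERIV_const])
    from DERIV_diff[OF DERIV_chain2[OF DERIV_real_sqrt[OF pos] this] DERIV_const[of e]]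
    show ?thesis unfolding \<Phi>_def \<Phi>'_def by (simp add: field_simps)
  qed
  have c': "continuous_on UNIV \<Phi>'"
    unfolding \<Phi>'_def using e by (intro continuous_intros) auto
  have near: "\<bar>max 0 (r - k) - \<Phi> r\<bar> \<le> e" for r
  proof -
    have "sqrt ((max 0 (r - k))\<^sup>2 + e\<^sup>2) \<le> max 0 (r - k) + e"
      using e by (intro real_le_lsqrt) (auto simp: power2_sum)
    moreover have "max 0 (r - k) \<le> sqrt ((max 0 (r - k))\<^sup>2 + e\<^sup>2)" by (intro real_le_rsqrt) auto
    ultimately show ?thesis unfolding \<Phi>_def by linarith
  qed
  have "inner (superpos \<Phi> u) f \<le> 0"
  proof (rule laplacian_dissipative_C1[OF uf D c'])
    show "\<Phi> 0 = 0" using k e by (simp add: \<Phi>_def)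
    show "0 \<le> \<Phi>' r" for r by (simp add: \<Phi>'_def)
    have "max 0 (r - k) \<le> sqrt ((max 0 (r - k))\<^sup>2 + e\<^sup>2)" for r by (intro real_le_rsqrt) auto
    then show "\<Phi>' r \<le> 1" for r unfolding \<Phi>'_def using pos[of r] by (simp add: divide_le_eq_1)
  qed
  moreover have adm: "admissible \<Phi>"
    unfolding admissible_def
  proof (intro conjI exI allI)
    show "\<Phi> \<in> borel_measurable borel" unfolding \<Phi>_def by measurable
    show "\<bar>\<Phi> r\<bar> \<le> (\<bar>k\<bar> + e) + 1 * \<bar>r\<bar>" for r using near[of r] by linarith
  qed
  have "norm (superpos (\<lambda>r. max 0 (r - k)) u - superpos \<Phi> u) \<le> e * norm one_\<Omega> + 0 * norm u"
  proof (rule norm_l2_le_affine)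
    show "AE x in lebesgue. \<bar>rep_l2 (superpos (\<lambda>r. max 0 (r - k)) u - superpos \<Phi> u) x\<bar>
        \<le> (if x \<in> \<Omega> then e else 0) + 0 * \<bar>rep_l2 u x\<bar>"
      using rep_superpos[OF admissible_pos_part, of k u] rep_superpos[OF adm, of u]
        rep_l2_diff[of "superpos (\<lambda>r. max 0 (r - k)) u" "superpos \<Phi> u"]
    proof eventually_elim
      case (elim x)
      then show ?case using near[of "rep_l2 u x"] by simp
    qed
  qed (use e in auto)
  then have "norm (superpos (\<lambda>r. max 0 (r - k)) u - superpos \<Phi> u) * norm f \<le> e * norm one_\<Omega> * norm f"
    by (intro mult_right_mono) auto
  moreover have "e * norm one_\<Omega> * norm f \<le> e * A" using e by (simp add: A_def algebra_simps)
  moreover have "e * A = d" using A by (simp add: e_def)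
  moreover have "inner (superpos (\<lambda>r. max 0 (r - k)) u - superpos \<Phi> u) f
      \<le> norm (superpos (\<lambda>r. max 0 (r - k)) u - superpos \<Phi> u) * norm f"
    by (rule norm_cauchy_schwarz)
  ultimately show "inner (superpos (\<lambda>r. max 0 (r - k)) u) f \<le> 0 + d"
    unfolding inner_diff_left by linarith
qed

lemma pos_part_dist_le:
  "norm (superpos (\<lambda>r. max 0 (r - k)) u - superpos (\<lambda>r. max 0 (r - k)) w) \<le> norm (u - w)"
proof -
  have "\<bar>max 0 (r - k) - max 0 (s - k)\<bar> \<le> \<bar>r - s\<bar>" for r s :: real by auto
  then show ?thesis
    using norm_superpos_diff[OF admissible_pos_part, of 0 1 u UNIV w k] by simp
qed

lemma heat_contraction:
  assumes t: "0 \<le> t" and u: "u \<in> L2 \<Omega>" shows "norm (S t u) \<le> norm u"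
proof (cases "t = 0")
  case False
  have "(norm (S t u))\<^sup>2 \<le> (norm u)\<^sup>2"
  proof (rule functional_nonincreasing[where B = "\<lambda>u w. 2 * inner u w" and C = 2 and J = "\<lambda>u. (norm u)\<^sup>2"])
    show "(norm w)\<^sup>2 \<le> (norm u)\<^sup>2 + 2 * inner u (w - u) + (norm (w - u))\<^sup>2" for u w :: "'a l2"
      by (simp add: power2_norm_eq_inner inner_diff_left inner_diff_right inner_commute)
    show "2 * inner u w \<le> 2 * norm u * norm w" for u w :: "'a l2"
      using norm_cauchy_schwarz[of u w] by simp
    show "2 * inner u f \<le> 0" if "(u, f) \<in> semigroup_generator (L2 \<Omega>) S" for u f
      using laplacian_dissipative that by (simp add: generator)
    show "continuous_on (L2 \<Omega>) (\<lambda>u. (norm u)\<^sup>2)" by (intro continuous_intros)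
  qed (use t u False in \<open>auto simp: inner_add_right\<close>)
  then show ?thesis by (rule power2_le_imp_le) simp
qed (use S_0 u in auto)

text \<open>The squared norm of the truncation has derivative \<open>2 * inner (?P u) w\<close> in
  direction \<open>w\<close>, which is nonpositive along the generator. The sign of \<open>k\<close>
  reflects the boundary condition: only for nonnegative \<open>k\<close> does the truncation
  preserve vanishing on the boundary.\<close>

lemma heat_order_contraction:
  assumes t: "0 \<le> t" and u: "u \<in> L2 \<Omega>" and k: "0 \<le> k"
  shows "norm (superpos (\<lambda>r. max 0 (r - k)) (S t u)) \<le> norm (superpos (\<lambda>r. max 0 (r - k)) u)"
proof (cases "t = 0")
  case False
  let ?P = "superpos (\<lambda>r. max 0 (r - k))"
  have bound: "norm (?P u) \<le> norm u" for u
    using k by (intro norm_l2_mono, use rep_superpos[OF admissible_pos_part, of k u] in eventually_elim) auto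
  have "(norm (?P (S t u)))\<^sup>2 \<le> (norm (?P u))\<^sup>2"
  proof (rule functional_nonincreasing[where B = "\<lambda>u w. 2 * inner (?P u) w" and C = 2 and J = "\<lambda>u. (norm (?P u))\<^sup>2"])
    fix u w :: "'a l2"
    assume uw: "u \<in> L2 \<Omega>" "w \<in> L2 \<Omega>"
    \<comment> \<open>After taking norms and squaring, this elementary inequality is exactly the
      one-sided second order expansion of \<open>J\<close>.\<close>
    have pointwise: "\<bar>max 0 (b - k)\<bar> \<le> \<bar>max 0 (a - k) + (b - a)\<bar>" for a b :: real
      by (simp add: max_def)
    have "norm (?P w) \<le> norm (?P u + (w - u))"
    proof (rule norm_l2_mono)
      show "AE x in lebesgue. \<bar>rep_l2 (?P w) x\<bar> \<le> \<bar>rep_l2 (?P u + (w - u)) x\<bar>"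
        using rep_superpos[OF admissible_pos_part, of k u] rep_superpos[OF admissible_pos_part, of k w]
          rep_l2_add[of "?P u" "w - u"] rep_l2_diff[of w u]
      proof eventually_elim
        case (elim x)
        then show ?case using pointwise[of "rep_l2 w x" "rep_l2 u x"] by simp
      qed
    qed
    then have "(norm (?P w))\<^sup>2 \<le> (norm (?P u + (w - u)))\<^sup>2" by (intro power_mono) auto
    also have "\<dots> = (norm (?P u))\<^sup>2 + 2 * inner (?P u) (w - u) + (norm (w - u))\<^sup>2"
      unfolding power2_norm_eq_inner by (simp add: inner_add_left inner_add_right inner_commute)
    finally show "(norm (?P w))\<^sup>2 \<le> (norm (?P u))\<^sup>2 + 2 * inner (?P u) (w - u) + (norm (w - u))\<^sup>2" .
    have "inner (?P u) w \<le> norm (?P u) * norm w" by (rule norm_cauchy_schwarz)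
    also have "\<dots> \<le> norm u * norm w" using bound by (intro mult_right_mono) auto
    finally show "2 * inner (?P u) w \<le> 2 * norm u * norm w" by simp
  next
    show "2 * inner (?P u) f \<le> 0" if "(u, f) \<in> semigroup_generator (L2 \<Omega>) S" for u f
      using laplacian_dissipative_pos_part[OF _ k] that by (simp add: generator)
    have "continuous_on (L2 \<Omega>) ?P"
      unfolding continuous_on_iff dist_norm by (blast intro: le_less_trans[OF pos_part_dist_le])
    then show "continuous_on (L2 \<Omega>) (\<lambda>u. (norm (?P u))\<^sup>2)" by (intro continuous_intros)
  qed (use t u False in \<open>auto simp: inner_add_right\<close>)
  then show ?thesis by (rule power2_le_imp_le) simp
qed (use S_0 u in auto)

end

subsection \<open>The source term\<close>

text \<open>In \<open>z powr b = z * z powr (b - 1)\<close> the second factor is nonincreasing, so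
  replacing it by its value at \<open>y\<close>, and then at \<open>d\<close>, only increases the
  difference.\<close>

lemma powr_increment:
  fixes x y d b :: real
  assumes "0 < d" "d \<le> y" "y \<le> x" "b \<le> 1"
  shows "x powr b - y powr b \<le> d powr (b - 1) * (x - y)"
proof -
  have eq: "z powr b = z * z powr (b - 1)" if "0 < z" for z :: real
    using that powr_add[of z 1 "b - 1"] by simp
  have "x powr b - y powr b = x * x powr (b - 1) - y * y powr (b - 1)"
    using assms by (simp add: eq[of x] eq[of y])
  also have "\<dots> \<le> x * y powr (b - 1) - y * y powr (b - 1)"
    using assms powr_mono2'[of "b - 1" y x] by (intro diff_right_mono mult_left_mono) auto
  also have "\<dots> = y powr (b - 1) * (x - y)" by (simp add: algebra_simps)
  also have "\<dots> \<le> d powr (b - 1) * (x - y)"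
    using assms powr_mono2'[of "b - 1" d y] by (intro mult_right_mono) auto
  finally show ?thesis .
qed

text \<open>The threshold \<open>d\<close> solves \<open>d powr b = e\<close>: below it the power
  varies by at most \<open>e\<close>, above it the increment is Lipschitz with constant
  \<open>d powr (b - 1)\<close>.\<close>

lemma powr_modulus:
  fixes b e :: real
  assumes b: "0 < b" "b \<le> 1" and e: "0 < e"
  shows "\<exists>C\<ge>0. \<forall>x\<ge>0. \<forall>y\<ge>0. \<bar>x powr b - y powr b\<bar> \<le> e + C * \<bar>x - y\<bar>"
proof -
  define d where "d = e powr (1 / b)"
  have d: "0 < d" "d powr b = e" using b e by (auto simp: d_def powr_powr)
  have *: "x powr b - y powr b \<le> e + d powr (b - 1) * (x - y)" if "0 \<le> y" "y \<le> x" for x y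
  proof (cases "x \<le> d")
    case True
    then have "x powr b \<le> e" using that b d by (metis order_trans powr_mono2 less_imp_le)
    moreover have "0 \<le> d powr (b - 1) * (x - y)" using that by simp
    moreover have "0 \<le> y powr b" by simp
    ultimately show ?thesis by linarith
  next
    case False
    define z where "z = max y d"
    have "x powr b - z powr b \<le> d powr (b - 1) * (x - z)"
      using False that d b by (intro powr_increment) (auto simp: z_def)
    also have "\<dots> \<le> d powr (b - 1) * (x - y)" by (intro mult_left_mono) (auto simp: z_def)
    finally have "x powr b - z powr b \<le> d powr (b - 1) * (x - y)" .
    moreover have "z powr b \<le> y powr b + e" using d e by (auto simp: z_def max_def)
    ultimately show ?thesis by linarith
  qed
  have "\<bar>x powr b - y powr b\<bar> \<le> e + d powr (b - 1) * \<bar>x - y\<bar>" if "0 \<le> x" "0 \<le> y" for x y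
  proof -
    have mono: "z powr b \<le> w powr b" if "0 \<le> z" "z \<le> w" for z w :: real
      using that b by (intro powr_mono2) auto
    show ?thesis
      using *[of y x] *[of x y] mono[of x y] mono[of y x] that by (cases "x \<le> y") auto
  qed
  then show ?thesis by (intro exI[of _ "d powr (b - 1)"]) auto
qed

locale pp_exponents =
  fixes \<alpha> \<beta> lam :: real
  assumes exponents: "0 < \<alpha>" "\<alpha> < \<beta>" "\<beta> \<le> 1" and lam: "0 < lam"
begin

lemma pp_source_modulus:
  assumes e: "0 < e"
  shows "\<exists>C\<ge>0. \<forall>r\<ge>0. \<forall>s\<ge>0. \<bar>pp_source \<alpha> \<beta> lam r - pp_source \<alpha> \<beta> lam s\<bar> \<le> e + C * \<bar>r - s\<bar>"
proof -
  obtain C1 where C1: "C1 \<ge> 0" "\<And>r s. 0 \<le> r \<Longrightarrow> 0 \<le> s \<Longrightarrow>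
      \<bar>r powr \<beta> - s powr \<beta>\<bar> \<le> e / (2 * lam) + C1 * \<bar>r - s\<bar>"
    using powr_modulus[of \<beta> "e / (2 * lam)"] exponents e lam by auto
  obtain C2 where C2: "C2 \<ge> 0" "\<And>r s. 0 \<le> r \<Longrightarrow> 0 \<le> s \<Longrightarrow>
      \<bar>r powr \<alpha> - s powr \<alpha>\<bar> \<le> e / 2 + C2 * \<bar>r - s\<bar>"
    using powr_modulus[of \<alpha> "e / 2"] exponents e by auto
  have "\<bar>pp_source \<alpha> \<beta> lam r - pp_source \<alpha> \<beta> lam s\<bar> \<le> e + (lam * C1 + C2) * \<bar>r - s\<bar>"
    if "0 \<le> r" "0 \<le> s" for r s
  proof -
    have "lam * \<bar>r powr \<beta> - s powr \<beta>\<bar> \<le> lam * (e / (2 * lam) + C1 * \<bar>r - s\<bar>)"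
      using C1(2)[OF that] lam by (intro mult_left_mono) auto
    also have "\<dots> = e / 2 + lam * C1 * \<bar>r - s\<bar>" using lam by (simp add: field_simps)
    finally have "\<bar>lam * (r powr \<beta> - s powr \<beta>)\<bar> \<le> e / 2 + lam * C1 * \<bar>r - s\<bar>"
      using lam by (simp add: abs_mult)
    moreover have "pp_source \<alpha> \<beta> lam r - pp_source \<alpha> \<beta> lam s
        = lam * (r powr \<beta> - s powr \<beta>) - (r powr \<alpha> - s powr \<alpha>)"
      by (simp add: pp_source_def algebra_simps)
    ultimately show ?thesis using C2(2)[OF that] by (simp add: distrib_right)
  qed
  then show ?thesis using C1(1) C2(1) lam by (intro exI[of _ "lam * C1 + C2"]) auto
qed

text \<open>The slope of \<open>r powr \<beta>\<close> is bounded above \<open>m\<close>, and the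
  absorption term \<open>- r powr \<alpha>\<close> is decreasing, so it only helps in an upper
  bound.\<close>

lemma pp_source_one_sided_lipschitz:
  assumes "0 < m" "m \<le> y" "y \<le> a"
  shows "pp_source \<alpha> \<beta> lam a - pp_source \<alpha> \<beta> lam y \<le> lam * m powr (\<beta> - 1) * (a - y)"
proof -
  have "a powr \<beta> - y powr \<beta> \<le> m powr (\<beta> - 1) * (a - y)"
    using assms exponents by (intro powr_increment) auto
  then have "lam * (a powr \<beta> - y powr \<beta>) \<le> lam * (m powr (\<beta> - 1) * (a - y))"
    using lam by (intro mult_left_mono) auto
  moreover have "y powr \<alpha> \<le> a powr \<alpha>" using assms exponents by (intro powr_mono2) auto
  ultimately show ?thesis by (simp add: pp_source_def algebra_simps)
qed

text \<open>Dividing the source by \<open>- y\<close> gives \<open>y powr (\<alpha> - 1) * (1 - lam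
  * y powr (\<beta> - \<alpha>))\<close>. Both factors are decreasing in \<open>y\<close> and
  nonnegative on \<open>(0, M]\<close>, so the smallest value is attained at \<open>M\<close>; it is
  the decay rate.\<close>

lemma pp_source_le:
  assumes "0 < y" "y \<le> M" and M: "lam * M powr (\<beta> - \<alpha>) \<le> 1"
  shows "pp_source \<alpha> \<beta> lam y \<le> - (M powr (\<alpha> - 1) * (1 - lam * M powr (\<beta> - \<alpha>))) * y"
proof -
  have eq: "y powr \<alpha> = y powr (\<alpha> - 1) * y" using assms powr_add[of y "\<alpha> - 1" 1] by simp
  have "y powr (\<beta> - \<alpha>) \<le> M powr (\<beta> - \<alpha>)" using assms exponents by (intro powr_mono2) auto
  then have "lam * y powr (\<beta> - \<alpha>) \<le> lam * M powr (\<beta> - \<alpha>)" using lam by (intro mult_left_mono) auto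
  moreover have "M powr (\<alpha> - 1) \<le> y powr (\<alpha> - 1)"
    using assms exponents by (intro powr_mono2') auto
  ultimately have "M powr (\<alpha> - 1) * (1 - lam * M powr (\<beta> - \<alpha>)) \<le> y powr (\<alpha> - 1) * (1 - lam * y powr (\<beta> - \<alpha>))"
    using M by (intro mult_mono) auto
  then have "M powr (\<alpha> - 1) * (1 - lam * M powr (\<beta> - \<alpha>)) * y \<le> y powr (\<alpha> - 1) * (1 - lam * y powr (\<beta> - \<alpha>)) * y"
    using assms by (intro mult_right_mono) auto
  also have "\<dots> = - pp_source \<alpha> \<beta> lam y"
  proof -
    have "y powr \<beta> = y powr \<alpha> * y powr (\<beta> - \<alpha>)" by (simp flip: powr_add)
    then show ?thesis by (simp add: pp_source_def eq algebra_simps)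
  qed
  finally show ?thesis by simp
qed

end

text \<open>The Euler step \<open>a \<mapsto> a + h * F a\<close> need not be monotone, but it fails to be so by at most \<open>h * e\<close>.\<close>

lemma euler_step_comparison:
  fixes F :: "real \<Rightarrow> real"
  assumes h: "0 < h" "h * C \<le> 1" and L: "0 \<le> L" and e: "0 \<le> e"
    and y': "y + h * F y \<le> y'"
    and modulus: "\<bar>F a - F y\<bar> \<le> e + C * \<bar>a - y\<bar>"
    and one_sided: "y \<le> a \<Longrightarrow> F a - F y \<le> L * (a - y)"
  shows "max 0 (a + h * F a - y') \<le> h * e + (1 + L * h) * max 0 (a - y)"
proof -
  have 1: "a + h * F a - y' \<le> (a - y) + h * (F a - F y)" using y' by (simp add: algebra_simps)
  show ?thesis
  proof (cases "y \<le> a")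
    case True
    have "h * (F a - F y) \<le> h * (L * (a - y))"
      using one_sided[OF True] h by (intro mult_left_mono) auto
    moreover have "0 \<le> L * h * (a - y)" "0 \<le> h * e" using L h e True by auto
    ultimately show ?thesis using 1 True by (simp add: algebra_simps)
  next
    case False
    \<comment> \<open>Below \<open>y\<close> the one-sided bound says nothing. The gap
      \<open>y - a\<close> itself absorbs the Lipschitz part of the modulus because
      \<open>h * C \<le> 1\<close>, leaving only \<open>h * e\<close>.\<close>
    have "h * (F a - F y) \<le> h * (e + C * (y - a))"
      using modulus False h by (intro mult_left_mono) auto
    also have "\<dots> = h * e + (h * C) * (y - a)" by (simp add: algebra_simps)
    also have "\<dots> \<le> h * e + 1 * (y - a)"
      using h False by (intro add_left_mono mult_right_mono) auto
    finally have "a + h * F a - y' \<le> h * e" using 1 by simp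
    moreover have "0 \<le> h * e" using h e by simp
    ultimately show ?thesis using False by simp
  qed
qed

section \<open>Euler steps for the mild formulation\<close>

context dirichlet_semigroup
begin

text \<open>Since every \<open>S t\<close> is a contraction, the error in \<open>g\<close> is not
  amplified, and what remains is the continuity of the single orbit of
  \<open>g (snd z0)\<close>.\<close>

lemma jointly_continuous:
  fixes T :: real
  assumes g: "continuous_on {0..T} g" "\<And>t. t \<in> {0..T} \<Longrightarrow> g t \<in> L2 \<Omega>"
  shows "continuous_on ({0..1} \<times> {0..T}) (\<lambda>z. S (fst z) (g (snd z)))"
  unfolding continuous_on_def
proof
  fix z0 :: "real \<times> real" assume z0: "z0 \<in> {0..1} \<times> {0..T}"
  let ?K = "{0..1::real} \<times> {0..T}"
  have "((\<lambda>z. S (fst z) (g (snd z)) - S (fst z0) (g (snd z0))) \<longlongrightarrow> 0) (at z0 within ?K)"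
  proof (rule Lim_null_comparison)
    show "\<forall>\<^sub>F z in at z0 within ?K. norm (S (fst z) (g (snd z)) - S (fst z0) (g (snd z0)))
        \<le> norm (g (snd z) - g (snd z0)) + norm (S (fst z) (g (snd z0)) - S (fst z0) (g (snd z0)))"
      unfolding eventually_at_filter
    proof (intro always_eventually allI impI)
      fix z assume z: "z \<in> ?K"
      then have z': "0 \<le> fst z" "snd z \<in> {0..T}" "snd z0 \<in> {0..T}" using z0 by auto
      have "S (fst z) (g (snd z)) - S (fst z0) (g (snd z0)) =
        S (fst z) (g (snd z) - g (snd z0)) + (S (fst z) (g (snd z0)) - S (fst z0) (g (snd z0)))"
        using z' g(2) by (simp add: S_diff)
      moreover have "norm (S (fst z) (g (snd z) - g (snd z0))) \<le> norm (g (snd z) - g (snd z0))"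
        using z' g(2) by (intro heat_contraction X_diff) auto
      ultimately show "norm (S (fst z) (g (snd z)) - S (fst z0) (g (snd z0)))
        \<le> norm (g (snd z) - g (snd z0)) + norm (S (fst z) (g (snd z0)) - S (fst z0) (g (snd z0)))"
        using norm_triangle_mono order_refl by metis
    qed
    have c1: "continuous_on ?K (\<lambda>z. g (snd z))"
      by (rule continuous_on_compose2[OF g(1)]) (auto intro!: continuous_intros)
    have "g (snd z0) \<in> L2 \<Omega>" using g(2) z0 by auto
    then have c2: "continuous_on ?K (\<lambda>z. S (fst z) (g (snd z0)))"
      by (intro continuous_on_compose2[OF S_continuous]) (auto intro!: continuous_intros)
    have "((\<lambda>z. norm (g (snd z) - g (snd z0)) + norm (S (fst z) (g (snd z0)) - S (fst z0) (g (snd z0))))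
       \<longlongrightarrow> norm (g (snd z0) - g (snd z0)) + norm (S (fst z0) (g (snd z0)) - S (fst z0) (g (snd z0)))) (at z0 within ?K)"
      using c1 c2 z0 by (intro tendsto_intros) (auto simp: continuous_on_def)
    then show "((\<lambda>z. norm (g (snd z) - g (snd z0)) + norm (S (fst z) (g (snd z0)) - S (fst z0) (g (snd z0))))
       \<longlongrightarrow> 0) (at z0 within ?K)" by simp
  qed
  then show "((\<lambda>z. S (fst z) (g (snd z))) \<longlongrightarrow> S (fst z0) (g (snd z0))) (at z0 within ?K)"
    by (rule LIM_zero_cancel)
qed

text \<open>Applying \<open>S h\<close> to the mild formula at \<open>t\<close> and subtracting it
  from the formula at \<open>t + h\<close> leaves the integral of \<open>S (t + h - s) (g s)\<close>
  over \<open>[t, t + h]\<close>. Uniform continuity on a compact rectangle replaces the integrand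
  by \<open>g t\<close>, with a step size independent of \<open>t\<close>.\<close>

lemma mild_solution_step:
  assumes g: "continuous_on {0..} g" "\<And>t. 0 \<le> t \<Longrightarrow> g t \<in> L2 \<Omega>"
    and v: "\<And>t. 0 \<le> t \<Longrightarrow> v t \<in> L2 \<Omega>" and u: "u \<in> L2 \<Omega>"
    and mild: "\<And>t. 0 \<le> t \<Longrightarrow> ((\<lambda>s. S (t - s) (g s)) has_integral (v t - S t u)) {0..t}"
    and e: "0 < e"
  shows "\<exists>d>0. \<forall>h t. 0 < h \<and> h < d \<and> 0 \<le> t \<and> t + h \<le> T \<longrightarrow>
    norm (v (t + h) - S h (v t + h *\<^sub>R g t)) \<le> e * h"
proof -
  let ?K = "{0..1::real} \<times> {0..T}"
  have "continuous_on {0..T} g" using g(1) by (rule continuous_on_subset) auto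
  then have "continuous_on ?K (\<lambda>z. S (fst z) (g (snd z)))" using g(2) by (intro jointly_continuous) auto
  then have "uniformly_continuous_on ?K (\<lambda>z. S (fst z) (g (snd z)))"
    by (rule compact_uniformly_continuous) (intro compact_Times compact_Icc)
  then obtain d where d: "d > 0" and uc: "\<And>z z'. z \<in> ?K \<Longrightarrow> z' \<in> ?K \<Longrightarrow> dist z' z < d \<Longrightarrow>
      dist (S (fst z') (g (snd z'))) (S (fst z) (g (snd z))) < e / 2"
    unfolding uniformly_continuous_on_def using e by (metis half_gt_zero)
  have near: "norm (S r (g s) - g t) \<le> e / 2"
    if "0 \<le> r" "r \<le> 1" "r < d / 2" "t \<le> s" "s - t < d / 2" "0 \<le> t" "s \<le> T" for r s t
  proof -
    have "dist (r, s) (0, t) \<le> \<bar>r\<bar> + \<bar>s - t\<bar>"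
      using sqrt_sum_squares_le_sum_abs[of r "s - t"] by (simp add: dist_Pair_Pair dist_real_def)
    then have "dist (r, s) (0, t) < d" using that by simp
    from uc[OF _ _ this] that g(2) show ?thesis by (auto simp: dist_norm S_0)
  qed
  show ?thesis
  proof (intro exI[of _ "min 1 (d / 2)"] conjI allI impI)
    show "0 < min 1 (d / 2)" using d by simp
  next
    fix h t assume "0 < h \<and> h < min 1 (d / 2) \<and> 0 \<le> t \<and> t + h \<le> T"
    then have h: "0 < h" "h < 1" "h < d / 2" and t: "0 \<le> t" "t + h \<le> T" by auto
    let ?F = "\<lambda>s. S (t + h - s) (g s)"
    have "((\<lambda>s. S h (proj (S (t - s) (g s)))) has_integral S h (proj (v t - S t u))) {0..t}"
      using has_integral_linear[OF mild[OF t(1)] SP_linear[of h]] h by (simp add: o_def)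
    moreover have "S h (proj (S (t - s) (g s))) = ?F s" if "s \<in> {0..t}" for s
      using that g(2) h S_plus[of h "t - s" "g s"] by (simp add: P_id S_in algebra_simps)
    moreover have "S h (proj (v t - S t u)) = S h (v t) - S (t + h) u"
      using t h u v S_plus[of h t u] by (simp add: P_id X_diff S_in S_diff add.commute)
    ultimately have 1: "(?F has_integral (S h (v t) - S (t + h) u)) {0..t}"
      by (metis (no_types, lifting) has_integral_eq)
    have 2: "(?F has_integral (v (t + h) - S (t + h) u)) {0..t + h}" using mild[of "t + h"] t h by simp
    then have int: "?F integrable_on {0..t + h}" by blast
    have int': "?F integrable_on {t..t + h}"
      using t h by (intro integrable_on_subinterval[OF int]) auto
    have "integral {0..t} ?F + integral {t..t + h} ?F = integral {0..t + h} ?F"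
      using t h int by (intro Henstock_Kurzweil_Integration.integral_combine) auto
    then have "integral {t..t + h} ?F = integral {0..t + h} ?F - integral {0..t} ?F"
      by (metis add_diff_cancel_left')
    also have "\<dots> = v (t + h) - S h (v t)"
      unfolding integral_unique[OF 1] integral_unique[OF 2] by simp
    finally have "integral {t..t + h} ?F = v (t + h) - S h (v t)" .
    then have 3: "(?F has_integral (v (t + h) - S h (v t))) {t..t + h}"
      using int' by (simp add: has_integral_integral)
    have "((\<lambda>s. ?F s - g t) has_integral (v (t + h) - S h (v t) - h *\<^sub>R g t)) {t..t + h}"
      using has_integral_diff[OF 3 has_integral_const_real[of "g t" t "t + h"]] h by simp
    moreover have "norm (?F s - g t) \<le> e / 2" if "s \<in> {t..t + h}" for s
      using that h t by (intro near) auto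
    ultimately have "norm (v (t + h) - S h (v t) - h *\<^sub>R g t) \<le> e / 2 * h"
      using has_integral_bound[of "e / 2" "\<lambda>s. ?F s - g t" _ t "t + h"] e h by simp
    \<comment> \<open>The second half of \<open>e\<close> pays for moving
      \<open>h *\<^sub>R g t\<close> under \<open>S h\<close>, so that the order estimate for the
      semigroup can later be applied to the complete Euler step.\<close>
    moreover have "norm (S h (g t) - g t) \<le> e / 2" using h t by (intro near) auto
    then have "norm (h *\<^sub>R (g t - S h (g t))) \<le> e / 2 * h" using h by (simp add: norm_minus_commute)
    moreover have eq: "v (t + h) - S h (v t + h *\<^sub>R g t)
        = (v (t + h) - S h (v t) - h *\<^sub>R g t) + h *\<^sub>R (g t - S h (g t))"
      using h t v g(2) by (simp add: S_add S_scale X_scale scaleR_diff_right)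
    have "norm (v (t + h) - S h (v t + h *\<^sub>R g t))
        \<le> norm (v (t + h) - S h (v t) - h *\<^sub>R g t) + norm (h *\<^sub>R (g t - S h (g t)))"
      unfolding eq by (rule norm_triangle_ineq)
    ultimately show "norm (v (t + h) - S h (v t + h *\<^sub>R g t)) \<le> e * h" by linarith
  qed
qed

end

subsection \<open>Comparison with the supersolution\<close>

locale pp_problem = dirichlet_semigroup \<Omega> S + pp_exponents \<alpha> \<beta> lam
  for \<Omega> :: "'a::euclidean_space set" and S :: "real \<Rightarrow> 'a l2 \<Rightarrow> 'a l2" and \<alpha> \<beta> lam :: real
begin

text \<open>Truncating the argument makes the source defined and of linear growth on the whole line,
  whatever the value of \<open>powr\<close> at negative numbers.\<close>

definition source :: "real \<Rightarrow> real" where "source r = pp_source \<alpha> \<beta> lam (max 0 r)"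

lemma source_modulus:
  assumes "0 < e"
  shows "\<exists>C\<ge>0. \<forall>r s. \<bar>source r - source s\<bar> \<le> e + C * \<bar>r - s\<bar>"
proof -
  obtain C where C: "C \<ge> 0" "\<And>r s. 0 \<le> r \<Longrightarrow> 0 \<le> s \<Longrightarrow>
      \<bar>pp_source \<alpha> \<beta> lam r - pp_source \<alpha> \<beta> lam s\<bar> \<le> e + C * \<bar>r - s\<bar>"
    using pp_source_modulus[OF assms] by blast
  have "\<bar>source r - source s\<bar> \<le> e + C * \<bar>r - s\<bar>" for r s
  proof -
    have "\<bar>source r - source s\<bar> \<le> e + C * \<bar>max 0 r - max 0 s\<bar>"
      unfolding source_def by (rule C(2)) auto
    also have "C * \<bar>max 0 r - max 0 s\<bar> \<le> C * \<bar>r - s\<bar>" using C(1) by (intro mult_left_mono) auto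
    finally show ?thesis by simp
  qed
  with C(1) show ?thesis by blast
qed

lemma admissible_source: "admissible source"
proof -
  obtain C where C: "C \<ge> 0" "\<And>r s. \<bar>source r - source s\<bar> \<le> 1 + C * \<bar>r - s\<bar>"
    using source_modulus[of 1] by auto
  have "source 0 = 0" by (simp add: source_def pp_source_def)
  then have "\<bar>source r\<bar> \<le> 1 + C * \<bar>r\<bar>" for r using C(2)[of r 0] by simp
  moreover have "source \<in> borel_measurable borel"
    unfolding source_def pp_source_def by measurable
  ultimately show ?thesis unfolding admissible_def by blast
qed

lemma superpos_source_continuous:
  fixes A :: "real set"
  assumes "continuous_on A v" shows "continuous_on A (\<lambda>t. superpos source (v t))"
  unfolding continuous_on_iff
proof (intro ballI allI impI)
  fix t e :: real assume t: "t \<in> A" and e: "0 < e"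
  obtain e1 where e1: "0 < e1" and e1': "e1 * norm one_\<Omega> \<le> e / 2"
    using small_factor[of "norm one_\<Omega>" "e / 2"] e by auto
  obtain C where C: "C \<ge> 0" "\<And>r s. \<bar>source r - source s\<bar> \<le> e1 + C * \<bar>r - s\<bar>"
    using source_modulus[OF e1] by blast
  have "0 < e / (2 * (C + 1))" using e C(1) by simp
  then obtain d where d: "d > 0" "\<And>s. s \<in> A \<Longrightarrow> dist s t < d \<Longrightarrow> dist (v s) (v t) < e / (2 * (C + 1))"
    using assms t unfolding continuous_on_iff by blast
  show "\<exists>d>0. \<forall>s\<in>A. dist s t < d \<longrightarrow> dist (superpos source (v s)) (superpos source (v t)) < e"
  proof (intro exI[of _ d] conjI ballI impI d(1))
    fix s assume "s \<in> A" "dist s t < d"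
    then have "norm (v s - v t) < e / (2 * (C + 1))" using d(2) by (simp add: dist_norm)
    then have "(C + 1) * norm (v s - v t) < e / 2" using C(1) by (simp add: field_simps)
    moreover have "norm (superpos source (v s) - superpos source (v t))
        \<le> e1 * norm one_\<Omega> + C * norm (v s - v t)"
      using e1 C by (intro norm_superpos_diff[where R = UNIV] admissible_source) auto
    ultimately show "dist (superpos source (v s)) (superpos source (v t)) < e"
      using e1' norm_ge_zero[of "v s - v t"] unfolding dist_norm distrib_right by linarith
  qed
qed

lemma solution_below_supersolution:
  assumes M: "0 < M" and k: "0 \<le> k" and super: "\<And>y. 0 < y \<Longrightarrow> y \<le> M \<Longrightarrow> source y \<le> - k * y"
    and v: "\<And>t. 0 \<le> t \<Longrightarrow> v t \<in> L2 \<Omega>" "continuous_on {0..} v"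
    and nonneg: "\<And>t. 0 \<le> t \<Longrightarrow> AE x in lebesgue. x \<in> \<Omega> \<longrightarrow> 0 \<le> rep_l2 (v t) x"
    and init: "AE x in lebesgue. x \<in> \<Omega> \<longrightarrow> rep_l2 (v 0) x \<le> M"
    and mild: "\<And>t. 0 \<le> t \<Longrightarrow>
      ((\<lambda>s. S (t - s) (superpos source (v s))) has_integral (v t - S t (v 0))) {0..t}"
    and T: "0 < T"
  shows "AE x in lebesgue. x \<in> \<Omega> \<longrightarrow> rep_l2 (v T) x \<le> M * exp (- k * T)"
proof -
  define y where "y t = M * exp (- k * t)" for t
  have y_pos: "0 < y t" for t using M by (simp add: y_def)
  have y_anti: "y t \<le> y s" if "s \<le> t" for s t
    using that M k by (simp add: y_def mult_left_mono)
  define Q where "Q b = superpos (\<lambda>r. max 0 (r - b))" for b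
  have rep_Q: "AE x in lebesgue. rep_l2 (Q b u) x = (if x \<in> \<Omega> then max 0 (rep_l2 u x - b) else 0)" for b u
    unfolding Q_def by (rule rep_superpos[OF admissible_pos_part])
  define g where "g t = superpos source (v t)" for t
  have g: "continuous_on {0..} g" "\<And>t. g t \<in> L2 \<Omega>"
    unfolding g_def using superpos_source_continuous[OF v(2)] superpos_in[OF admissible_source] by auto
  \<comment> \<open>On \<open>[0, T]\<close> the supersolution is smallest at \<open>T\<close>, so
    one Lipschitz constant taken at level \<open>y T\<close> serves all times.\<close>
  define L where "L = lam * y T powr (\<beta> - 1)"
  have L: "0 \<le> L" using lam by (simp add: L_def)
  have one_sided: "source a - source (y t) \<le> L * (a - y t)" if "t \<le> T" "y t \<le> a" for a t
    using pp_source_one_sided_lipschitz[of "y T" "y t" a] that y_pos[of t] y_pos[of T] y_anti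
    by (simp add: source_def L_def)
  \<comment> \<open>The supersolution inequality for the Euler scheme is exact, without an error
    term, because \<open>1 - k * h \<le> exp (- k * h)\<close>.\<close>
  have y_step: "y t + h * source (y t) \<le> y (t + h)" if "0 \<le> t" "0 < h" for t h
  proof -
    have "y t \<le> M" using y_anti[of 0 t] that by (simp add: y_def)
    then have "h * source (y t) \<le> h * (- k * y t)"
      using super y_pos that by (intro mult_left_mono) auto
    moreover have "y t * (1 + - k * h) \<le> y t * exp (- k * h)"
      using y_pos[of t] by (intro mult_left_mono exp_ge_add_one_self) auto
    moreover have "y t * exp (- k * h) = y (t + h)"
      by (simp add: y_def algebra_simps flip: exp_add)
    ultimately show ?thesis by (simp add: algebra_simps)
  qed
  have "norm (Q (y T) (v T)) \<le> exp (L * T) * norm (Q (y 0) (v 0))"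
  proof (rule discrete_gronwall[where q = "\<lambda>t. norm (Q (y t) (v t))", OF T L])
    fix e :: real assume e: "0 < e"
    obtain e1 where e1: "0 < e1" and e1': "e1 * norm one_\<Omega> \<le> e / 2"
      using small_factor[of "norm one_\<Omega>" "e / 2"] e by auto
    obtain C where C: "C \<ge> 0" "\<And>r s. \<bar>source r - source s\<bar> \<le> e1 + C * \<bar>r - s\<bar>"
      using source_modulus[OF e1] by blast
    have v0: "v 0 \<in> L2 \<Omega>" using v(1) by simp
    have e2: "0 < e / 2" using e by simp
    obtain d where d: "d > 0" and step: "\<And>h t. 0 < h \<Longrightarrow> h < d \<Longrightarrow> 0 \<le> t \<Longrightarrow> t + h \<le> T \<Longrightarrow>
        norm (v (t + h) - S h (v t + h *\<^sub>R g t)) \<le> e / 2 * h"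
      using mild_solution_step[OF g(1) g(2) v(1) v0 mild[folded g_def] e2, of T] by auto
    show "\<exists>d>0. \<forall>h s. 0 < h \<and> h < d \<and> 0 \<le> s \<and> s + h \<le> T \<longrightarrow>
        norm (Q (y (s + h)) (v (s + h))) \<le> (1 + L * h) * norm (Q (y s) (v s)) + e * h"
    proof (intro exI[of _ "min d (1 / (C + 1))"] conjI allI impI)
      show "0 < min d (1 / (C + 1))" using d C(1) by simp
    next
      fix h t assume "0 < h \<and> h < min d (1 / (C + 1)) \<and> 0 \<le> t \<and> t + h \<le> T"
      then have h: "0 < h" "h < d" "h < 1 / (C + 1)" and t: "0 \<le> t" "t + h \<le> T" by auto
      have hC: "h * C \<le> 1"
      proof -
        have "h * (C + 1) < 1" using h(3) C(1) by (simp add: field_simps)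
        then show ?thesis using h(1) by (simp add: algebra_simps)
      qed
      define z where "z = v t + h *\<^sub>R g t"
      have z: "z \<in> L2 \<Omega>" unfolding z_def using v(1) g(2) t by (intro X_add X_scale) auto
      \<comment> \<open>The excess over the new level \<open>y (t + h)\<close> changes by the
        consistency error when \<open>v (t + h)\<close> becomes \<open>S h z\<close>, and does not
        decrease when \<open>S h\<close> is removed, the level being constant in space. The Euler
        comparison then returns to the excess over \<open>y t\<close>.\<close>
      have "norm (Q (y (t + h)) (v (t + h))) \<le> norm (Q (y (t + h)) (S h z)) + norm (v (t + h) - S h z)"
        using pos_part_dist_le[of "y (t + h)" "v (t + h)" "S h z"]
          norm_triangle_sub[of "Q (y (t + h)) (v (t + h))" "Q (y (t + h)) (S h z)"]
        unfolding Q_def by linarith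
      moreover have "norm (Q (y (t + h)) (S h z)) \<le> norm (Q (y (t + h)) z)"
        unfolding Q_def using h z y_pos[of "t + h"] by (intro heat_order_contraction) auto
      moreover have "norm (Q (y (t + h)) z) \<le> (h * e1) * norm one_\<Omega> + (1 + L * h) * norm (Q (y t) (v t))"
      proof (rule norm_l2_le_affine)
        show "AE x in lebesgue. \<bar>rep_l2 (Q (y (t + h)) z) x\<bar>
            \<le> (if x \<in> \<Omega> then h * e1 else 0) + (1 + L * h) * \<bar>rep_l2 (Q (y t) (v t)) x\<bar>"
          using rep_Q[of "y (t + h)" z] rep_Q[of "y t" "v t"] rep_l2_add[of "v t" "h *\<^sub>R g t"]
            rep_l2_scaleR[of h "g t"] rep_superpos[OF admissible_source, of "v t"]
        proof eventually_elim
          case (elim x)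
          show ?case
          proof (cases "x \<in> \<Omega>")
            case True
            define a where "a = rep_l2 (v t) x"
            have "max 0 (a + h * source a - y (t + h)) \<le> h * e1 + (1 + L * h) * max 0 (a - y t)"
              using h hC L e1 t
              by (intro euler_step_comparison[where C = C] y_step C(2) one_sided) auto
            moreover have "rep_l2 z x = a + h * source a"
              using elim True by (simp add: z_def a_def g_def)
            ultimately show ?thesis using elim True by (simp add: a_def)
          qed (use elim in simp)
        qed
      qed (use h e1 L in auto)
      moreover have "h * (e1 * norm one_\<Omega>) \<le> h * (e / 2)" using e1' h by (intro mult_left_mono) auto
      moreover have "norm (v (t + h) - S h z) \<le> e / 2 * h" unfolding z_def by (rule step[OF h(1,2) t])
      ultimately show "norm (Q (y (t + h)) (v (t + h))) \<le> (1 + L * h) * norm (Q (y t) (v t)) + e * h"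
        by (simp add: algebra_simps)
    qed
  qed simp
  also have "norm (Q (y 0) (v 0)) \<le> 0 * norm one_\<Omega> + 0 * norm (v 0)"
  proof (rule norm_l2_le_affine)
    show "AE x in lebesgue. \<bar>rep_l2 (Q (y 0) (v 0)) x\<bar> \<le> (if x \<in> \<Omega> then 0 else 0) + 0 * \<bar>rep_l2 (v 0) x\<bar>"
      using rep_Q[of "y 0" "v 0"] init by eventually_elim (auto simp: y_def)
  qed auto
  finally have "Q (y T) (v T) = 0" by simp
  then have "AE x in lebesgue. rep_l2 (Q (y T) (v T)) x = 0"
    using rep_l2_scaleR[of 0 "Q (y T) (v T)"] by simp
  then show ?thesis using rep_Q[of "y T" "v T"]
    by eventually_elim (auto simp: y_def max_def split: if_splits)
qed

end

section \<open>Exponential decay of the sup norm\<close>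

theorem proposition3:
  fixes \<Omega> :: "'a::euclidean_space set"
    and \<alpha> \<beta> lam :: real
    and v\<^sub>0 :: "'a \<Rightarrow> real"
    and S :: "real \<Rightarrow> 'a l2 \<Rightarrow> 'a l2"
    and v :: "real \<Rightarrow> 'a l2"
  assumes "open \<Omega>" and "connected \<Omega>" and "\<Omega> \<noteq> {}" and "bounded \<Omega>" and "C1_boundary \<Omega>"
    and "0 < \<alpha>" and "\<alpha> < \<beta>" and "\<beta> \<le> 1"
    and "v\<^sub>0 \<in> Linf \<Omega>" and "AE x in lebesgue_on \<Omega>. 0 \<le> v\<^sub>0 x"
    and "\<beta> = 1 \<or>
      (\<exists>K\<^sub>0>0. AE x in lebesgue_on \<Omega>. v\<^sub>0 x \<ge> K\<^sub>0 * infdist x (frontier \<Omega>) powr (2 / (1 - \<alpha>)))"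
    and "0 < lam"
    and "Linf_norm \<Omega> v\<^sub>0 < ereal (lam powr (- 1 / (\<beta> - \<alpha>)))"
    and "dirichlet_heat_semigroup \<Omega> S"
    and "pp_solution \<Omega> S \<alpha> \<beta> lam v\<^sub>0 v"
  shows "((\<lambda>t. Linf_norm \<Omega> (rep_l2 (v t))) \<longlongrightarrow> 0) at_top"
proof -
  interpret pp_problem \<Omega> S \<alpha> \<beta> lam
    using assms by unfold_locales auto
  have AE_\<Omega>: "(AE x in lebesgue_on \<Omega>. P x) \<longleftrightarrow> (AE x in lebesgue. x \<in> \<Omega> \<longrightarrow> P x)" for P
    by (rule AE_restrict_space_iff) simp
  have sol: "\<And>t. 0 \<le> t \<Longrightarrow> v t \<in> L2 \<Omega>" "continuous_on {0..} v"
    "\<And>t. 0 \<le> t \<Longrightarrow> AE x in lebesgue. x \<in> \<Omega> \<longrightarrow> 0 \<le> rep_l2 (v t) x"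
    "\<And>t. 0 \<le> t \<Longrightarrow> ((\<lambda>s. S (t - s) (l2_on \<Omega> (\<lambda>x. pp_source \<alpha> \<beta> lam (rep_l2 (v s) x))))
        has_integral (v t - S t (l2_on \<Omega> v\<^sub>0))) {0..t}"
    using assms(15) unfolding pp_solution_def AE_\<Omega> by blast+

  \<comment> \<open>The positive zero of the source:
    \<open>lam * c powr (\<beta> - \<alpha>) = 1\<close>. Any \<open>M\<close> strictly below it
    gives a positive decay rate \<open>k\<close>.\<close>
  define c where "c = lam powr (- 1 / (\<beta> - \<alpha>))"
  have c: "0 < c" using lam by (simp add: c_def)
  \<comment> \<open>The maximum with 0 forces \<open>M\<close> to be positive, also when the initial
    datum vanishes almost everywhere.\<close>
  have "max 0 (Linf_norm \<Omega> v\<^sub>0) < ereal c" using assms(13) c by (simp add: c_def)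
  then obtain M where "max 0 (Linf_norm \<Omega> v\<^sub>0) < ereal M" "ereal M < ereal c"
    using ereal_dense2 by blast
  then have M: "0 < M" "Linf_norm \<Omega> v\<^sub>0 < ereal M" "M < c" by (auto simp: zero_ereal_def)
  define k where "k = M powr (\<alpha> - 1) * (1 - lam * M powr (\<beta> - \<alpha>))"
  have "M powr (\<beta> - \<alpha>) < c powr (\<beta> - \<alpha>)" using M exponents by (intro powr_less_mono2) auto
  also have "c powr (\<beta> - \<alpha>) = 1 / lam"
  proof -
    have "- 1 / (\<beta> - \<alpha>) * (\<beta> - \<alpha>) = - 1" using exponents by simp
    then show ?thesis unfolding c_def powr_powr using lam by (simp add: powr_minus_divide)
  qed
  finally have lamM: "lam * M powr (\<beta> - \<alpha>) < 1" using lam by (simp add: field_simps)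
  then have k: "0 < k" using M by (simp add: k_def)

  have v0: "AE x in lebesgue. x \<in> \<Omega> \<longrightarrow> \<bar>v\<^sub>0 x\<bar> \<le> M"
    using esssup_AE[of "\<lambda>x. ereal \<bar>v\<^sub>0 x\<bar>" "lebesgue_on \<Omega>"] unfolding AE_\<Omega>
  proof eventually_elim
    case (elim x)
    then show ?case using M(2) by (metis Linf_norm_def ereal_less_eq(3) le_less_trans less_imp_le)
  qed
  have "(\<lambda>x. if x \<in> \<Omega> then v\<^sub>0 x else 0) \<in> borel_measurable lebesgue"
    using assms(9) by (simp add: Linf_def borel_measurable_if)
  moreover have "AE x in lebesgue. x \<in> \<Omega> \<longrightarrow> \<bar>if x \<in> \<Omega> then v\<^sub>0 x else 0\<bar> \<le> M"
    using v0 by eventually_elim simp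
  ultimately have "square_integrable (\<lambda>x. if x \<in> \<Omega> then (if x \<in> \<Omega> then v\<^sub>0 x else 0) else 0)"
    by (rule square_integrable_bounded)
  then have sq0: "square_integrable (\<lambda>x. if x \<in> \<Omega> then v\<^sub>0 x else 0)" by (simp cong: if_cong)
  \<comment> \<open>The initial condition is contained in the mild formulation at time 0, where the
    integral over a single point vanishes.\<close>
  have "v 0 - S 0 (l2_on \<Omega> v\<^sub>0) = 0"
    using sol(4)[of 0] by (intro has_integral_unique[OF _ has_integral_refl(2)]) simp
  then have v_0: "v 0 = l2_on \<Omega> v\<^sub>0" using S_0[OF l2_on_in_L2[OF sq0]] by simp

  \<comment> \<open>The solution is nonnegative almost everywhere, where truncation changes nothing.
    Square integrability of the untruncated source has to be transferred along this equality before
    the two classes can be compared.\<close>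
  have source_eq: "l2_on \<Omega> (\<lambda>x. pp_source \<alpha> \<beta> lam (rep_l2 (v s) x)) = superpos source (v s)" if "0 \<le> s" for s
  proof -
    have "AE x in lebesgue. x \<in> \<Omega> \<longrightarrow> pp_source \<alpha> \<beta> lam (rep_l2 (v s) x) = source (rep_l2 (v s) x)"
      using sol(3)[OF that] by eventually_elim (simp add: source_def)
    then have ae: "AE x in lebesgue. (if x \<in> \<Omega> then pp_source \<alpha> \<beta> lam (rep_l2 (v s) x) else 0)
        = (if x \<in> \<Omega> then source (rep_l2 (v s) x) else 0)"
      by eventually_elim simp
    have "(\<lambda>x. if x \<in> \<Omega> then pp_source \<alpha> \<beta> lam (rep_l2 (v s) x) else 0) \<in> borel_measurable lebesgue"
      unfolding pp_source_def by measurable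
    moreover have "integrable lebesgue (\<lambda>x. (if x \<in> \<Omega> then pp_source \<alpha> \<beta> lam (rep_l2 (v s) x) else 0)\<^sup>2)
        \<longleftrightarrow> integrable lebesgue (\<lambda>x. (if x \<in> \<Omega> then source (rep_l2 (v s) x) else 0)\<^sup>2)"
    proof (rule integrable_cong_AE)
      show "AE x in lebesgue. (if x \<in> \<Omega> then pp_source \<alpha> \<beta> lam (rep_l2 (v s) x) else 0)\<^sup>2
          = (if x \<in> \<Omega> then source (rep_l2 (v s) x) else 0)\<^sup>2"
        using ae by eventually_elim simp
    qed (use calculation square_integrable_superpos[OF admissible_source, of "v s"]
        in \<open>auto simp: square_integrable_def intro!: borel_measurable_power\<close>)
    ultimately show ?thesis
      using square_integrable_superpos[OF admissible_source, of "v s"] ae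
      unfolding l2_on_def superpos_def by (intro abs_l2_eqI) (auto simp: square_integrable_def)
  qed
  have mild: "((\<lambda>s. S (t - s) (superpos source (v s))) has_integral (v t - S t (v 0))) {0..t}" if "0 \<le> t" for t
    using sol(4)[OF that] unfolding v_0 by (rule has_integral_eq[rotated]) (simp add: source_eq)

  have bound: "AE x in lebesgue. x \<in> \<Omega> \<longrightarrow> rep_l2 (v t) x \<le> M * exp (- k * t)" if "0 < t" for t
  proof (rule solution_below_supersolution[OF M(1) less_imp_le[OF k] _ sol(1-3) _ mild that])
    show "source y \<le> - k * y" if "0 < y" "y \<le> M" for y
      using pp_source_le[OF that] lamM that by (simp add: source_def k_def)
    show "AE x in lebesgue. x \<in> \<Omega> \<longrightarrow> rep_l2 (v 0) x \<le> M"
      unfolding v_0 using rep_l2_on[OF sq0] v0 by eventually_elim auto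
  qed
  have meas: "(\<lambda>x. ereal \<bar>rep_l2 (v t) x\<bar>) \<in> borel_measurable (lebesgue_on \<Omega>)" for t
    by (rule measurable_restrict_space1) simp
  have upper: "Linf_norm \<Omega> (rep_l2 (v t)) \<le> ereal (M * exp (- k * t))" if "0 < t" for t
    unfolding Linf_norm_def
  proof (rule esssup_I[OF meas])
    show "AE x in lebesgue_on \<Omega>. ereal \<bar>rep_l2 (v t) x\<bar> \<le> ereal (M * exp (- k * t))"
      unfolding AE_\<Omega> using bound[OF that] sol(3)[OF less_imp_le[OF that]] by eventually_elim auto
  qed
  \<comment> \<open>An essential supremum over a null set would be minus infinity; a nonempty open
    set has positive measure.\<close>
  have lower: "0 \<le> Linf_norm \<Omega> (rep_l2 (v t))" for t
  proof -
    have "\<not> negligible \<Omega>" using open_not_negligible[OF open_\<Omega>] assms(3) by blast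
    then have "emeasure (lebesgue_on \<Omega>) (space (lebesgue_on \<Omega>)) \<noteq> 0"
      by (simp add: negligible_iff_null_sets null_sets_def emeasure_restrict_space)
    then have "esssup (lebesgue_on \<Omega>) (\<lambda>x. 0::ereal) = 0" by (rule esssup_const)
    moreover have "esssup (lebesgue_on \<Omega>) (\<lambda>x. 0::ereal) \<le> Linf_norm \<Omega> (rep_l2 (v t))"
      unfolding Linf_norm_def by (rule esssup_mono) auto
    ultimately show ?thesis by simp
  qed
  have "((\<lambda>t. M * exp (- k * t)) \<longlongrightarrow> 0) at_top" using k by real_asymp
  then have "((\<lambda>t. ereal (M * exp (- k * t))) \<longlongrightarrow> 0) at_top" by (simp add: zero_ereal_def)
  then show ?thesis
    by (rule tendsto_sandwich[rotated 3, where f = "\<lambda>_. 0"])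
      (use lower upper in \<open>auto intro: eventually_mono[OF eventually_gt_at_top[of 0]]\<close>)
qed

end
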